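(* Let $f(x;w)$ be a ResNet or a DenseNet (as defined in the context), with all weights i.i.d. standard normal, evaluated at a fixed input $x\in\mathbb{R}^{n_0}$ with $\|x\|_2=1$. Then for every non-negative even integer $m$ and every weight matrix $W^{\mathbf{k}}$ of the network, $$\mathbb{E}_w\big[(f_{(\mathbf{k})}(x;w))^{m}\big]=\mathbb{E}_w\big[(f_{\mathbf{k}}(x;w))^{m}\big].$$
   Context: $\phi(t)=\max(0,t)$ is the ReLU, applied coordinatewise. All weight entries are i.i.d. $\mathcal{N}(0,1)$. ResNet with residual branches of depth $m_b$: $f(x;w)=\frac{1}{\sqrt{n_L}}W^{L}y^L$ with final projection $W^{L}$ a row vector (distinct from the branch matrices $W^{L,h}$); $y^0=\frac{1}{\sqrt{n_0}}W^0x$; for $l\in[L]$, $y^l=y^{l-1}+\sqrt{\alpha_l}\,y^{l-1,m_b}$, where $y^{l-1,1}=\frac{1}{\sqrt{n_{l-1}}}W^{l,1}y^{l-1}$, $y^{l-1,h}=\frac{1}{\sqrt{n_{l-1,h-1}}}W^{l,h}q^{l-1,h-1}$ for $1<h\le m_b$, and $q^{l-1,h}=\sqrt2\,\phi(y^{l-1,h})$; $\alpha_l>0$ are scaling constants, $n_{l-1,h}$ is the dimension of $y^{l-1,h}$, $n_l$ that of $y^l$, and dimensions are compatible (so all $y^l$ have the same dimension). DenseNet: $f(x;w)=\frac{1}{\sqrt{n_L}}W^{L}y^L$ (final row-vector projection $W^L$); $y^0=\frac{1}{\sqrt{n_0}}W^0x$; for $l\in[L]$, $y^l=\sqrt{\frac{\alpha}{n_{l-1}\,l}}\sum_{h=0}^{l-1}W^{l,h}q^h$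 with $q^h=\sqrt2\,\phi(y^h)$, $\alpha>0$, and $W^{l,h}$ having $n_l$ rows and as many columns as the dimension of $q^h$. Path decomposition: for fixed $x,w$, $f(x;w)=\sum_{\gamma\in S}c_\gamma z_\gamma\prod_{l=1}^{|\gamma|}w_{\gamma,l}$, where $S$ is the set of input-to-output paths in the computation graph (through weight edges, identity skip connections and concatenations), $w_{\gamma,l}$ are the weights along $\gamma$, $c_\gamma$ collects the constant factors (scalings, $\sqrt2$'s, input coordinate), and $z_\gamma\in\{0,1\}$ indicates that all ReLUs along $\gamma$ are active. For a weight matrix $W^{\mathbf{k}}$, let $S_{\mathbf{k}}$ be the paths using a weight of $W^{\mathbf{k}}$, and $f_{\mathbf{k}}(x;w)=\sum_{\gamma\in S_{\mathbf{k}}}c_\gamma z_\gamma\prod_l w_{\gamma,l}$. Reduced network $f_{(\mathbf{k})}(x;w)$: the network obtained from $f$ by removing all connections bypassing $W^{\mathbf{k}}$ (same weights, recomputed activations). Concretely, for a ResNet and $\mathbf{k}=(l_k,h)$ a branch matrix, the recursion at layer $l_k$ becomes $y^{l_k}=\sqrt{\alpha_{l_k}}\,y^{l_k-1,m_b}$ (identity term dropped), all else unchanged; for a DenseNet and $\mathbf{k}=(l_k,h_k)$, $y^{l_k}=\sqrt{\frac{\alpha}{n_{l_k-1}l_k}}W^{l_k,h_k}q^{h_k}$ and for $l>l_k$, $y^l=\sqrt{\frac{\alpha}{n_{l-1}l}}\sum_{h=l_k}^{l-1}W^{l,h}q^h$; for the first and last projections $W^0,W^L$ nothing is removed. *)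

theory Defs
  imports "HOL-Probability.Probability"
begin

text \<open>Weight matrix names: MIn = W^0 (first projection), MOut = W^L (final row-vector
projection), MHid l h = the matrix W^{l,h} (ResNet branch matrix or DenseNet matrix).
A weight entry is indexed by (matrix, row, column).\<close>

datatype mkey = MIn | MOut | MHid nat nat

type_synonym weights = "mkey \<times> nat \<times> nat \<Rightarrow> real"

datatype ekind = Ident | Wt mkey

text \<open>An edge from node esrc to node etgt: the source vector (passed through
q = sqrt 2 * relu if eact) is multiplied by the weight matrix (or identity) and by the
constant ecoef, then added into the target node.\<close>
datatype edge = Edge (esrc: nat) (etgt: nat) (ekd: ekind) (ecoef: real) (eact: bool)

record graph =
  gdim :: "nat \<Rightarrow> nat"
  gedges :: "edge list"
  gout :: nat

definition relu :: "real \<Rightarrow> real" where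
  "relu t = max 0 t"

definition actv :: "edge \<Rightarrow> real \<Rightarrow> real" where
  "actv e y = (if eact e then sqrt 2 * relu y else y)"

definition edge_contrib ::
  "graph \<Rightarrow> weights \<Rightarrow> (nat \<Rightarrow> nat \<Rightarrow> real) \<Rightarrow> edge \<Rightarrow> nat \<Rightarrow> real" where
  "edge_contrib G w T e i = ecoef e *
     (case ekd e of
        Ident \<Rightarrow> actv e (T (esrc e) i)
      | Wt k \<Rightarrow> (\<Sum>j<gdim G (esrc e). w (k, i, j) * actv e (T (esrc e) j)))"

text \<open>Forward evaluation, nodes in topological order; node 0 is the input x.\<close>
primrec tab :: "graph \<Rightarrow> (nat \<Rightarrow> real) \<Rightarrow> weights \<Rightarrow> nat \<Rightarrow> (nat \<Rightarrow> nat \<Rightarrow> real)" where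
  "tab G x w 0 = (\<lambda>v i. if v = 0 then x i else 0)"
| "tab G x w (Suc m) = (let T = tab G x w m in
     T(Suc m := (\<lambda>i. \<Sum>e\<leftarrow>filter (\<lambda>e. etgt e = Suc m \<and> esrc e < Suc m) (gedges G).
                        edge_contrib G w T e i)))"

definition nval :: "graph \<Rightarrow> (nat \<Rightarrow> real) \<Rightarrow> weights \<Rightarrow> nat \<Rightarrow> nat \<Rightarrow> real" where
  "nval G x w v i = tab G x w v v i"

text \<open>Network output f(x;w) (the output node is one-dimensional).\<close>
definition net_out :: "graph \<Rightarrow> (nat \<Rightarrow> real) \<Rightarrow> weights \<Rightarrow> real" where
  "net_out G x w = nval G x w (gout G) 0"

text \<open>A path is a start unit i0 of the input node together with a list of steps
(edge index, target unit), going through the graph to the output node.\<close>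
fun vp :: "graph \<Rightarrow> nat \<Rightarrow> nat \<Rightarrow> (nat \<times> nat) list \<Rightarrow> bool" where
  "vp G v i [] = (v = gout G)"
| "vp G v i ((e, j) # r) =
     (e < length (gedges G) \<and> esrc (gedges G ! e) = v \<and> v < etgt (gedges G ! e)
      \<and> j < gdim G (etgt (gedges G ! e))
      \<and> (ekd (gedges G ! e) = Ident \<longrightarrow> j = i)
      \<and> vp G (etgt (gedges G ! e)) j r)"

definition paths :: "graph \<Rightarrow> (nat \<times> (nat \<times> nat) list) set" where
  "paths G = {(i0, st). i0 < gdim G 0 \<and> vp G 0 i0 st}"

fun pcoef :: "graph \<Rightarrow> nat \<Rightarrow> (nat \<times> nat) list \<Rightarrow> real" where
  "pcoef G i [] = 1"
| "pcoef G i ((e, j) # r) =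
     ecoef (gedges G ! e) * (if eact (gedges G ! e) then sqrt 2 else 1) * pcoef G j r"

fun pgate :: "graph \<Rightarrow> (nat \<Rightarrow> real) \<Rightarrow> weights \<Rightarrow> nat \<Rightarrow> (nat \<times> nat) list \<Rightarrow> real" where
  "pgate G x w i [] = 1"
| "pgate G x w i ((e, j) # r) =
     (if eact (gedges G ! e) \<and> \<not> (nval G x w (esrc (gedges G ! e)) i > 0) then 0 else 1)
     * pgate G x w j r"

fun pweight :: "graph \<Rightarrow> weights \<Rightarrow> nat \<Rightarrow> (nat \<times> nat) list \<Rightarrow> real" where
  "pweight G w i [] = 1"
| "pweight G w i ((e, j) # r) =
     (case ekd (gedges G ! e) of Ident \<Rightarrow> 1 | Wt k \<Rightarrow> w (k, j, i)) * pweight G w j r"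

definition path_uses :: "graph \<Rightarrow> mkey \<Rightarrow> nat \<times> (nat \<times> nat) list \<Rightarrow> bool" where
  "path_uses G k \<gamma> = (\<exists>(e, j) \<in> set (snd \<gamma>). ekd (gedges G ! e) = Wt k)"

definition f_path :: "graph \<Rightarrow> mkey \<Rightarrow> (nat \<Rightarrow> real) \<Rightarrow> weights \<Rightarrow> real" where
  "f_path G k x w = (\<Sum>\<gamma> \<in> {\<gamma> \<in> paths G. path_uses G k \<gamma>}.
      x (fst \<gamma>) * pcoef G (fst \<gamma>) (snd \<gamma>) * pgate G x w (fst \<gamma>) (snd \<gamma>)
        * pweight G w (fst \<gamma>) (snd \<gamma>))"

definition gkeys :: "graph \<Rightarrow> mkey set" where
  "gkeys G = {k. \<exists>e \<in> set (gedges G). ekd e = Wt k}"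

definition wset :: "graph \<Rightarrow> (mkey \<times> nat \<times> nat) set" where
  "wset G = {(k, i, j). \<exists>e \<in> set (gedges G). ekd e = Wt k
                \<and> i < gdim G (etgt e) \<and> j < gdim G (esrc e)}"

definition wmeasure :: "graph \<Rightarrow> weights measure" where
  "wmeasure G = PiM (wset G) (\<lambda>_. density lborel std_normal_density)"

definition Ew :: "graph \<Rightarrow> (weights \<Rightarrow> real) \<Rightarrow> real" where
  "Ew G F = integral\<^sup>L (wmeasure G) F"

text \<open>Node numbering: 0 = x; rY l = y^l; rB l h = y^{l-1,h} (1 \<le> h \<le> mb);
output node = rY L + 1. Branch dimension n_{l-1,h} = nb (l-1) h; all y^l have dimension n.
The flag dropk l removes the identity skip connection into y^l.\<close>
definition rY :: "nat \<Rightarrow> nat \<Rightarrow> nat" where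
  "rY mb l = 1 + l * (mb + 1)"

definition rB :: "nat \<Rightarrow> nat \<Rightarrow> nat \<Rightarrow> nat" where
  "rB mb l h = 1 + (l - 1) * (mb + 1) + h"

definition resnet_edges ::
  "nat \<Rightarrow> nat \<Rightarrow> (nat \<Rightarrow> nat \<Rightarrow> nat) \<Rightarrow> (nat \<Rightarrow> real) \<Rightarrow> nat \<Rightarrow> nat \<Rightarrow> (nat \<Rightarrow> bool) \<Rightarrow> edge list" where
  "resnet_edges n0 n nb \<alpha> L mb dropk =
     [Edge 0 1 (Wt MIn) (1 / sqrt (real n0)) False]
     @ concat (map (\<lambda>l.
          [Edge (rY mb (l - 1)) (rB mb l 1) (Wt (MHid l 1)) (1 / sqrt (real n)) False]
          @ map (\<lambda>h. Edge (rB mb l (h - 1)) (rB mb l h) (Wt (MHid l h))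
                          (1 / sqrt (real (nb (l - 1) (h - 1)))) True) [2..<mb + 1]
          @ [Edge (rB mb l mb) (rY mb l) Ident (sqrt (\<alpha> l)) False]
          @ (if dropk l then [] else [Edge (rY mb (l - 1)) (rY mb l) Ident 1 False]))
        [1..<L + 1])
     @ [Edge (rY mb L) (rY mb L + 1) (Wt MOut) (1 / sqrt (real n)) False]"

definition resnet_dim :: "nat \<Rightarrow> nat \<Rightarrow> (nat \<Rightarrow> nat \<Rightarrow> nat) \<Rightarrow> nat \<Rightarrow> nat \<Rightarrow> nat \<Rightarrow> nat" where
  "resnet_dim n0 n nb L mb v =
     (if v = 0 then n0
      else if v = rY mb L + 1 then 1
      else if (v - 1) mod (mb + 1) = 0 then n
      else nb ((v - 1) div (mb + 1)) ((v - 1) mod (mb + 1)))"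

definition resnet_graph ::
  "nat \<Rightarrow> nat \<Rightarrow> (nat \<Rightarrow> nat \<Rightarrow> nat) \<Rightarrow> (nat \<Rightarrow> real) \<Rightarrow> nat \<Rightarrow> nat \<Rightarrow> (nat \<Rightarrow> bool) \<Rightarrow> graph" where
  "resnet_graph n0 n nb \<alpha> L mb dropk =
     \<lparr> gdim = resnet_dim n0 n nb L mb, gedges = resnet_edges n0 n nb \<alpha> L mb dropk,
       gout = rY mb L + 1 \<rparr>"

definition resnet :: "nat \<Rightarrow> nat \<Rightarrow> (nat \<Rightarrow> nat \<Rightarrow> nat) \<Rightarrow> (nat \<Rightarrow> real) \<Rightarrow> nat \<Rightarrow> nat \<Rightarrow> graph" where
  "resnet n0 n nb \<alpha> L mb = resnet_graph n0 n nb \<alpha> L mb (\<lambda>_. False)"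

definition resnet_reduced ::
  "nat \<Rightarrow> nat \<Rightarrow> (nat \<Rightarrow> nat \<Rightarrow> nat) \<Rightarrow> (nat \<Rightarrow> real) \<Rightarrow> nat \<Rightarrow> nat \<Rightarrow> mkey \<Rightarrow> graph" where
  "resnet_reduced n0 n nb \<alpha> L mb k =
     (case k of MHid lk h \<Rightarrow> resnet_graph n0 n nb \<alpha> L mb (\<lambda>l. l = lk)
              | _ \<Rightarrow> resnet n0 n nb \<alpha> L mb)"

text \<open>Node numbering: 0 = x; l + 1 = y^l (dimension nd l); L + 2 = output.
keep l h says whether the matrix W^{l,h} (from q^h into y^l) is present.\<close>
definition dense_edges ::
  "nat \<Rightarrow> (nat \<Rightarrow> nat) \<Rightarrow> real \<Rightarrow> nat \<Rightarrow> (nat \<Rightarrow> nat \<Rightarrow> bool) \<Rightarrow> edge list" where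
  "dense_edges n0 nd \<alpha> L keep =
     [Edge 0 1 (Wt MIn) (1 / sqrt (real n0)) False]
     @ concat (map (\<lambda>l. map (\<lambda>h. Edge (h + 1) (l + 1) (Wt (MHid l h))
                                    (sqrt (\<alpha> / (real (nd (l - 1)) * real l))) True)
                              (filter (keep l) [0..<l]))
               [1..<L + 1])
     @ [Edge (L + 1) (L + 2) (Wt MOut) (1 / sqrt (real (nd L))) False]"

definition dense_dim :: "nat \<Rightarrow> (nat \<Rightarrow> nat) \<Rightarrow> nat \<Rightarrow> nat \<Rightarrow> nat" where
  "dense_dim n0 nd L v = (if v = 0 then n0 else if v = L + 2 then 1 else nd (v - 1))"

definition dense_graph ::
  "nat \<Rightarrow> (nat \<Rightarrow> nat) \<Rightarrow> real \<Rightarrow> nat \<Rightarrow> (nat \<Rightarrow> nat \<Rightarrow> bool) \<Rightarrow> graph" where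
  "dense_graph n0 nd \<alpha> L keep =
     \<lparr> gdim = dense_dim n0 nd L, gedges = dense_edges n0 nd \<alpha> L keep, gout = L + 2 \<rparr>"

definition densenet :: "nat \<Rightarrow> (nat \<Rightarrow> nat) \<Rightarrow> real \<Rightarrow> nat \<Rightarrow> graph" where
  "densenet n0 nd \<alpha> L = dense_graph n0 nd \<alpha> L (\<lambda>_ _. True)"

definition dense_reduced :: "nat \<Rightarrow> (nat \<Rightarrow> nat) \<Rightarrow> real \<Rightarrow> nat \<Rightarrow> mkey \<Rightarrow> graph" where
  "dense_reduced n0 nd \<alpha> L k =
     (case k of MHid lk hk \<Rightarrow>
        dense_graph n0 nd \<alpha> L (\<lambda>l h. if l = lk then h = hk else if lk < l then lk \<le> h else True)
      | _ \<Rightarrow> densenet n0 nd \<alpha> L)"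

end

theory Submission
  imports Defs
begin

text \<open>
The network \<open>f\<^sub>k\<close> of paths through \<open>W\<^sup>k\<close> is the reduced network made linear: it has the same edges,
but its ReLU gates are those of the full network. For a gated unit let \<open>y\<close> be its preactivation in
the full network and \<open>z\<close> the one in this linear network. Multiply all weights into the unit and all
weights out of it by the sign of \<open>y z\<close>. The reduced network then has preactivation \<open>\<bar>z\<bar> sgn y\<close>,
so that its own gates agree with those of the full network, and up to sign it computes \<open>f\<^sub>k\<close>.

The signs depend on the weights, so this is not a change of variables by itself. It is averaged over the
finite group of all constant sign patterns \<open>s\<close>, each of which preserves the Gaussian measure. Both \<open>y\<close>
and \<open>z\<close> are odd in the weights into the unit, so the aligning sign of \<open>s w\<close> at a unit depends only on
\<open>s\<close> at earlier nodes. Hence multiplying \<open>s\<close> by the aligning signs of \<open>s w\<close> is a triangular map, a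
bijection of the group, and for almost every \<open>w\<close> the even powers of the two networks have the same
sum over the orbit of \<open>w\<close>. The exceptions are the weights where \<open>y = 0\<close> and \<open>z \<noteq> 0\<close> for some unit, a null set
because \<open>y\<close> is affine in each single weight.
\<close>

section \<open>Linear networks with prescribed gates\<close>

definition gate_factor :: "(nat \<Rightarrow> nat \<Rightarrow> bool) \<Rightarrow> edge \<Rightarrow> nat \<Rightarrow> real" where
  "gate_factor g e j = (if eact e then (if g (esrc e) j then sqrt 2 else 0) else 1)"

text \<open>With the gates as a separate argument the contribution is linear in \<open>T\<close>,
  and the gates of one network can drive the values of another.\<close>

definition gated_contrib ::
  "graph \<Rightarrow> weights \<Rightarrow> (nat \<Rightarrow> nat \<Rightarrow> bool) \<Rightarrow> (nat \<Rightarrow> nat \<Rightarrow> real) \<Rightarrow> edge \<Rightarrow> nat \<Rightarrow> real" where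
  "gated_contrib G w g T e i = ecoef e *
     (case ekd e of
        Ident \<Rightarrow> gate_factor g e i * T (esrc e) i
      | Wt k \<Rightarrow> (\<Sum>j<gdim G (esrc e). w (k, i, j) * (gate_factor g e j * T (esrc e) j)))"

text \<open>Positions rather than edges: paths record positions in the edge list, and equal edges at
  different positions count separately.\<close>

definition incoming :: "graph \<Rightarrow> (edge \<Rightarrow> bool) \<Rightarrow> nat \<Rightarrow> nat set" where
  "incoming G q v = {a. a < length (gedges G) \<and> q (gedges G ! a)
     \<and> etgt (gedges G ! a) = v \<and> esrc (gedges G ! a) < v}"

lemma finite_incoming [simp]: "finite (incoming G q v)"
  by (simp add: incoming_def)

text \<open>The linear network on the edges satisfying \<open>q\<close> in which the ReLU of unit \<open>j\<close> of
node \<open>u\<close> is replaced by multiplication with the prescribed gate \<open>g u j\<close>.\<close>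

function gated_lin ::
  "graph \<Rightarrow> (edge \<Rightarrow> bool) \<Rightarrow> (nat \<Rightarrow> nat \<Rightarrow> bool) \<Rightarrow> (nat \<Rightarrow> real) \<Rightarrow> weights \<Rightarrow> nat \<Rightarrow> nat \<Rightarrow> real" where
  "gated_lin G q g x w v i = (if v = 0 then x i else
     \<Sum>a\<in>incoming G q v. gated_contrib G w g
       (\<lambda>u j. if u < v then gated_lin G q g x w u j else 0) (gedges G ! a) i)"
  by pat_completeness auto
termination by (relation "Wellfounded.measure (\<lambda>(G, q, g, x, w, v, i). v)") auto

declare gated_lin.simps [simp del]

abbreviation gates :: "graph \<Rightarrow> (nat \<Rightarrow> real) \<Rightarrow> weights \<Rightarrow> nat \<Rightarrow> nat \<Rightarrow> bool" where
  "gates G x w \<equiv> (\<lambda>u j. nval G x w u j > 0)"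

abbreviation subnet :: "graph \<Rightarrow> (edge \<Rightarrow> bool) \<Rightarrow> graph" where
  "subnet G q \<equiv> G\<lparr>gedges := filter q (gedges G)\<rparr>"

lemma gated_contrib_cong:
  assumes "\<And>j. T (esrc e) j = T' (esrc e) j"
    and "\<And>j. eact e \<Longrightarrow> g (esrc e) j = g' (esrc e) j"
    and "\<And>k j. ekd e = Wt k \<Longrightarrow> w (k, i, j) = w' (k, i, j)"
  shows "gated_contrib G w g T e i = gated_contrib G w' g' T' e i"
proof -
  have "gate_factor g e j = gate_factor g' e j" for j
    using assms(2) by (auto simp: gate_factor_def)
  then show ?thesis using assms(1,3)
    by (auto simp: gated_contrib_def split: ekind.split)
qed

lemma gated_lin_0 [simp]: "gated_lin G q g x w 0 i = x i"
  by (simp add: gated_lin.simps)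

text \<open>The guard \<open>u < v\<close> in \<open>gated_lin\<close> is there for termination;
  sources of incoming edges lie below \<open>v\<close>, so it drops out.\<close>

lemma gated_lin_rec:
  assumes "0 < v"
  shows "gated_lin G q g x w v i =
    (\<Sum>a\<in>incoming G q v. gated_contrib G w g (gated_lin G q g x w) (gedges G ! a) i)"
  using assms by (subst gated_lin.simps)
    (auto simp: incoming_def intro!: sum.cong gated_contrib_cong)

text \<open>ReLU multiplies by its own gate. At 0 the strict gate is closed, but the product is 0
  either way.\<close>

lemma edge_contrib_eq_gated:
  "edge_contrib G w T e i = gated_contrib G w (\<lambda>u j. T u j > 0) T e i"
proof -
  have "actv e (T (esrc e) j) = gate_factor (\<lambda>u j. T u j > 0) e j * T (esrc e) j" for j
    by (auto simp: actv_def gate_factor_def relu_def max_def)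
  then show ?thesis by (simp add: edge_contrib_def gated_contrib_def split: ekind.split)
qed

lemma sum_list_filter_nth:
  fixes f :: "'a \<Rightarrow> real"
  shows "(\<Sum>e\<leftarrow>filter P es. f e) = (\<Sum>a | a < length es \<and> P (es ! a). f (es ! a))"
proof -
  have "(\<Sum>e\<leftarrow>filter P es. f e) = (\<Sum>e\<leftarrow>es. if P e then f e else 0)"
    by (simp add: sum_list_map_filter')
  also have "\<dots> = (\<Sum>a\<in>{0..<length es}. if P (es ! a) then f (es ! a) else 0)"
    by (simp add: sum_list_sum_nth)
  also have "\<dots> = (\<Sum>a | a \<in> {0..<length es} \<and> P (es ! a). f (es ! a))"
    by (rule sum.inter_filter[symmetric]) simp
  finally show ?thesis by simp
qed

lemma tab_stable: "v \<le> m \<Longrightarrow> tab G x w m v = tab G x w v v"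
proof (induction m)
  case (Suc m)
  then show ?case by (cases "v = Suc m") (auto simp: Let_def)
qed simp

lemma nval_0 [simp]: "nval G x w 0 i = x i"
  by (simp add: nval_def)

text \<open>The sum runs over positions in the edge list of \<open>G\<close>, not of the filtered
  list, so that the subnetwork can be compared with \<open>G\<close> edge by edge.\<close>

lemma nval_subnet_rec:
  assumes "0 < v"
  shows "nval (subnet G q) x w v i =
    (\<Sum>a\<in>incoming G q v. gated_contrib G w (gates (subnet G q) x w)
       (nval (subnet G q) x w) (gedges G ! a) i)"
proof -
  let ?R = "subnet G q"
  obtain m where v: "v = Suc m" using assms by (cases v) auto
  have "nval ?R x w v i =
    (\<Sum>e\<leftarrow>filter (\<lambda>e. q e \<and> etgt e = v \<and> esrc e < v) (gedges G).
       edge_contrib ?R w (tab ?R x w m) e i)"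
    by (simp add: nval_def v Let_def conj_commute conj_left_commute)
  also have "\<dots> = (\<Sum>a\<in>incoming G q v.
       edge_contrib ?R w (tab ?R x w m) (gedges G ! a) i)"
    by (simp add: sum_list_filter_nth incoming_def)
  also have "\<dots> = (\<Sum>a\<in>incoming G q v. gated_contrib G w (gates (subnet G q) x w)
       (nval (subnet G q) x w) (gedges G ! a) i)"
  proof (rule sum.cong[OF refl])
    fix a assume "a \<in> incoming G q v"
    then have "esrc (gedges G ! a) \<le> m" by (simp add: incoming_def v)
    then have *: "tab ?R x w m (esrc (gedges G ! a)) j = nval ?R x w (esrc (gedges G ! a)) j" for j
      using tab_stable[of "esrc (gedges G ! a)" m ?R x w] by (simp add: nval_def)
    have "edge_contrib ?R w (tab ?R x w m) (gedges G ! a) i =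
        gated_contrib ?R w (gates ?R x w) (nval ?R x w) (gedges G ! a) i"
      unfolding edge_contrib_eq_gated by (rule gated_contrib_cong) (simp_all add: *)
    then show "edge_contrib ?R w (tab ?R x w m) (gedges G ! a) i =
        gated_contrib G w (gates ?R x w) (nval ?R x w) (gedges G ! a) i"
      by (simp add: gated_contrib_def split: ekind.splits)
  qed
  finally show ?thesis .
qed

lemma nval_subnet_eq_gated_lin:
  "nval (subnet G q) x w v i = gated_lin G q (gates (subnet G q) x w) x w v i"
proof (induction v arbitrary: i rule: less_induct)
  case (less v)
  show ?case
  proof (cases "v = 0")
    case False
    then show ?thesis
      by (subst nval_subnet_rec, simp, subst gated_lin_rec, simp)
        (auto intro!: sum.cong gated_contrib_cong less simp: incoming_def)
  qed simp
qed

lemma subnet_all [simp]: "subnet G (\<lambda>_. True) = G"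
  by simp

lemma nval_eq_gated_lin: "nval G x w v i = gated_lin G (\<lambda>_. True) (gates G x w) x w v i"
  by (rule nval_subnet_eq_gated_lin[where q = "\<lambda>_. True", unfolded subnet_all])

lemma nval_rec:
  assumes "0 < v"
  shows "nval G x w v i = (\<Sum>a\<in>incoming G (\<lambda>_. True) v.
    gated_contrib G w (gates G x w) (nval G x w) (gedges G ! a) i)"
  by (rule nval_subnet_rec[OF assms, where q = "\<lambda>_. True", unfolded subnet_all])

lemma gated_lin_cong:
  assumes "\<And>e k i j. e \<in> set (gedges G) \<Longrightarrow> etgt e \<le> v \<Longrightarrow> ekd e = Wt k \<Longrightarrow> w (k, i, j) = w' (k, i, j)"
    and "\<And>u j. u < v \<Longrightarrow> g u j = g' u j"
  shows "gated_lin G q g x w v i = gated_lin G q g' x w' v i"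
  using assms
proof (induction v arbitrary: i rule: less_induct)
  case (less v)
  show ?case
  proof (cases "v = 0")
    case False
    show ?thesis unfolding gated_lin_rec[OF False[unfolded neq0_conv]]
    proof (intro sum.cong refl gated_contrib_cong)
      fix a j assume a: "a \<in> incoming G q v"
      show "gated_lin G q g x w (esrc (gedges G ! a)) j = gated_lin G q g' x w' (esrc (gedges G ! a)) j"
        by (rule less.IH) (use a less.prems in \<open>auto simp: incoming_def\<close>)
    next
      fix a j assume a: "a \<in> incoming G q v"
      show "g (esrc (gedges G ! a)) j = g' (esrc (gedges G ! a)) j"
        by (rule less.prems) (use a in \<open>auto simp: incoming_def\<close>)
    next
      fix a k j assume a: "a \<in> incoming G q v" "ekd (gedges G ! a) = Wt k"
      show "w (k, i, j) = w' (k, i, j)"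
        by (rule less.prems(1)[of "gedges G ! a"]) (use a in \<open>auto simp: incoming_def\<close>)
    qed
  qed simp
qed

text \<open>Unlike in \<open>gated_lin_cong\<close> the gates depend on the weights; strong
  induction settles the gates below \<open>v\<close> first.\<close>

lemma nval_cong:
  assumes "\<And>e k i j. e \<in> set (gedges G) \<Longrightarrow> etgt e \<le> v \<Longrightarrow> ekd e = Wt k \<Longrightarrow> w (k, i, j) = w' (k, i, j)"
  shows "nval G x w v i = nval G x w' v i"
  using assms
proof (induction v arbitrary: i rule: less_induct)
  case (less v)
  show ?case
    unfolding nval_eq_gated_lin[of G x _ v i]
  proof (rule gated_lin_cong)
    fix u j assume "u < v"
    then have "nval G x w u j = nval G x w' u j"
      by (intro less.IH less.prems) auto
    then show "(0 < nval G x w u j) = (0 < nval G x w' u j)" by simp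
  qed (rule less.prems)
qed

section \<open>Path sums\<close>

text \<open>What both architectures share. \<open>key_unique\<close> makes values affine in each
  single weight. The last two conditions keep gates away from the input, whose sign is fixed, and
  from the ends of identity edges, where no weight could absorb a sign flip.\<close>

locale feedforward =
  fixes G :: graph
  assumes key_unique: "\<lbrakk>e \<in> set (gedges G); e' \<in> set (gedges G); ekd e = Wt k; ekd e' = Wt k\<rbrakk> \<Longrightarrow> e = e'"
    and edge_forward: "e \<in> set (gedges G) \<Longrightarrow> esrc e < etgt e \<and> etgt e \<le> gout G"
    and ecoef_pos: "e \<in> set (gedges G) \<Longrightarrow> 0 < ecoef e"
    and ident_edge: "\<lbrakk>e \<in> set (gedges G); ekd e = Ident\<rbrakk> \<Longrightarrow> gdim G (esrc e) = gdim G (etgt e) \<and> \<not> eact e"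
    and out_dim: "gdim G (gout G) = 1"
    and active_source: "\<lbrakk>e \<in> set (gedges G); eact e\<rbrakk> \<Longrightarrow> 0 < esrc e"
    and active_source_ident: "\<lbrakk>e \<in> set (gedges G); eact e; e' \<in> set (gedges G); ekd e' = Ident\<rbrakk>
      \<Longrightarrow> esrc e' \<noteq> esrc e \<and> etgt e' \<noteq> esrc e"
begin

text \<open>The matrix of one edge, from source unit \<open>i\<close> to target unit
  \<open>j\<close>; weights list the target first. Identity edges become diagonal matrices, so that
  the forward and backward recursions treat all edges alike.\<close>

definition transfer :: "(nat \<Rightarrow> nat \<Rightarrow> bool) \<Rightarrow> weights \<Rightarrow> edge \<Rightarrow> nat \<Rightarrow> nat \<Rightarrow> real" where
  "transfer g w e i j = ecoef e * gate_factor g e i *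
     (case ekd e of Ident \<Rightarrow> (if j = i then 1 else 0) | Wt k \<Rightarrow> w (k, j, i))"

definition suffixes :: "(edge \<Rightarrow> bool) \<Rightarrow> nat \<Rightarrow> nat \<Rightarrow> (nat \<times> nat) list set" where
  "suffixes q v i = {st. vp G v i st \<and> (\<forall>s\<in>set st. q (gedges G ! fst s))}"

definition pvalue :: "(nat \<Rightarrow> real) \<Rightarrow> weights \<Rightarrow> nat \<Rightarrow> (nat \<times> nat) list \<Rightarrow> real" where
  "pvalue x w i st = pcoef G i st * pgate G x w i st * pweight G w i st"

definition suffix_sum :: "(edge \<Rightarrow> bool) \<Rightarrow> (nat \<Rightarrow> real) \<Rightarrow> weights \<Rightarrow> nat \<Rightarrow> nat \<Rightarrow> real" where
  "suffix_sum q x w v i = (\<Sum>st\<in>suffixes q v i. pvalue x w i st)"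

definition outgoing :: "(edge \<Rightarrow> bool) \<Rightarrow> nat \<Rightarrow> nat set" where
  "outgoing q v = {a. a < length (gedges G) \<and> q (gedges G ! a) \<and> esrc (gedges G ! a) = v}"

definition succ_units :: "nat \<Rightarrow> nat \<Rightarrow> nat set" where
  "succ_units i a = {j. j < gdim G (etgt (gedges G ! a)) \<and> (ekd (gedges G ! a) = Ident \<longrightarrow> j = i)}"

lemma finite_outgoing [simp]: "finite (outgoing q v)"
  by (simp add: outgoing_def)

lemma finite_succ_units [simp]: "finite (succ_units i a)"
  by (simp add: succ_units_def)

lemma suffixes_unfold:
  "suffixes q v i = (if v = gout G then {[]} else {}) \<union>
     (\<lambda>((a, j), st). (a, j) # st) `
       (SIGMA p:(SIGMA a:outgoing q v. succ_units i a). suffixes q (etgt (gedges G ! fst p)) (snd p))"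
proof (intro set_eqI)
  fix st
  show "st \<in> suffixes q v i \<longleftrightarrow> st \<in> (if v = gout G then {[]} else {}) \<union>
     (\<lambda>((a, j), st). (a, j) # st) `
       (SIGMA p:(SIGMA a:outgoing q v. succ_units i a). suffixes q (etgt (gedges G ! fst p)) (snd p))"
  proof (cases st)
    case Nil
    then show ?thesis by (auto simp: suffixes_def)
  next
    case (Cons s r)
    obtain a j where s: "s = (a, j)" by (cases s)
    have "a < length (gedges G) \<Longrightarrow> esrc (gedges G ! a) < etgt (gedges G ! a)"
      using edge_forward by simp
    then show ?thesis using Cons s
      by (auto simp: suffixes_def image_iff outgoing_def succ_units_def)
  qed
qed

lemma finite_suffixes [simp]: "finite (suffixes q v i)"
proof (induction "gout G - v" arbitrary: v i rule: less_induct)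
  case less
  have "finite (suffixes q (etgt (gedges G ! a)) j)" if "a \<in> outgoing q v" for a j
    using that edge_forward[of "gedges G ! a"] by (intro less) (auto simp: outgoing_def)
  then show ?case
    by (subst suffixes_unfold) (auto intro!: finite_imageI finite_SigmaI)
qed

lemma pvalue_Cons:
  assumes "a \<in> outgoing q v" "j \<in> succ_units i a"
  shows "pvalue x w i ((a, j) # st) = transfer (gates G x w) w (gedges G ! a) i j * pvalue x w j st"
  using assms
  by (auto simp: pvalue_def transfer_def gate_factor_def succ_units_def split: ekind.split)

text \<open>The backward recursion, splitting a path at its first step; the 1 stands for the empty
  path at the output.\<close>

lemma suffix_sum_rec:
  "suffix_sum q x w v i = (if v = gout G then 1 else 0) +
     (\<Sum>a\<in>outgoing q v. \<Sum>j<gdim G (etgt (gedges G ! a)).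
        transfer (gates G x w) w (gedges G ! a) i j * suffix_sum q x w (etgt (gedges G ! a)) j)"
proof -
  let ?S = "SIGMA p:(SIGMA a:outgoing q v. succ_units i a). suffixes q (etgt (gedges G ! fst p)) (snd p)"
  let ?c = "\<lambda>((a, j), st). (a, j) # st :: (nat \<times> nat) list"
  have fS: "finite ?S" by (auto intro!: finite_SigmaI)
  have inj: "inj_on ?c ?S" by (auto simp: inj_on_def)
  have "suffix_sum q x w v i = sum (pvalue x w i) (if v = gout G then {[]} else {})
      + sum (pvalue x w i) (?c ` ?S)"
    unfolding suffix_sum_def by (subst suffixes_unfold, rule sum.union_disjoint) (use fS in auto)
  also have "sum (pvalue x w i) (if v = gout G then {[]} else {}) = (if v = gout G then 1 else 0)"
    by (simp add: pvalue_def)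
  also have "sum (pvalue x w i) (?c ` ?S) = (\<Sum>p\<in>?S. pvalue x w i (?c p))"
    using inj by (simp add: sum.reindex)
  also have "\<dots> = (\<Sum>p\<in>(SIGMA a:outgoing q v. succ_units i a).
      \<Sum>st\<in>suffixes q (etgt (gedges G ! fst p)) (snd p). pvalue x w i (?c (p, st)))"
    by (subst sum.Sigma) (auto intro!: finite_SigmaI sum.cong)
  also have "\<dots> = (\<Sum>p\<in>(SIGMA a:outgoing q v. succ_units i a).
      transfer (gates G x w) w (gedges G ! fst p) i (snd p) *
        suffix_sum q x w (etgt (gedges G ! fst p)) (snd p))"
    unfolding suffix_sum_def sum_distrib_left
    by (intro sum.cong refl) (auto simp: pvalue_Cons)
  also have "\<dots> = (\<Sum>a\<in>outgoing q v. \<Sum>j\<in>succ_units i a.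
      transfer (gates G x w) w (gedges G ! a) i j * suffix_sum q x w (etgt (gedges G ! a)) j)"
    by (subst sum.Sigma) (auto intro!: sum.cong)
  \<comment> \<open>Off the diagonal the transfer along an identity edge is 0, so the inner sum may
    run over all target units.\<close>
  also have "\<dots> = (\<Sum>a\<in>outgoing q v. \<Sum>j<gdim G (etgt (gedges G ! a)).
        transfer (gates G x w) w (gedges G ! a) i j * suffix_sum q x w (etgt (gedges G ! a)) j)"
    by (intro sum.cong[OF refl] sum.mono_neutral_left) (auto simp: succ_units_def transfer_def)
  finally show ?thesis .
qed

lemma gated_lin_transfer:
  assumes "0 < v" "i < gdim G v"
  shows "gated_lin G q g x w v i = (\<Sum>a\<in>incoming G q v. \<Sum>j<gdim G (esrc (gedges G ! a)).
    transfer g w (gedges G ! a) j i * gated_lin G q g x w (esrc (gedges G ! a)) j)"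
  unfolding gated_lin_rec[OF assms(1)]
proof (rule sum.cong[OF refl])
  fix a assume a: "a \<in> incoming G q v"
  let ?e = "gedges G ! a"
  show "gated_contrib G w g (gated_lin G q g x w) ?e i =
    (\<Sum>j<gdim G (esrc ?e). transfer g w ?e j i * gated_lin G q g x w (esrc ?e) j)"
  proof (cases "ekd ?e")
    case Ident
    \<comment> \<open>Equal dimensions at both ends put the diagonal term inside the sum over source
      units.\<close>
    then have "i < gdim G (esrc ?e)"
      using a assms ident_edge[of ?e] by (auto simp: incoming_def)
    moreover have "(\<Sum>j<gdim G (esrc ?e). transfer g w ?e j i * gated_lin G q g x w (esrc ?e) j) =
       (\<Sum>j<gdim G (esrc ?e). if i = j then ecoef ?e * gate_factor g ?e i * gated_lin G q g x w (esrc ?e) i else 0)"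
      by (intro sum.cong refl) (auto simp: transfer_def Ident)
    ultimately show ?thesis by (simp add: gated_contrib_def Ident)
  next
    case (Wt k)
    then show ?thesis
      by (auto simp: gated_contrib_def transfer_def sum_distrib_left mult_ac intro!: sum.cong)
  qed
qed

text \<open>The forward and the backward recursion have adjoint solution operators.\<close>

lemma path_sum_eq_gated_lin:
  "(\<Sum>i<gdim G 0. x i * suffix_sum q x w 0 i) = gated_lin G q (gates G x w) x w (gout G) 0"
proof -
  let ?E = "\<lambda>a. gedges G ! a"
  let ?l = "gated_lin G q (gates G x w) x w"
  let ?b = "suffix_sum q x w"
  let ?t = "\<lambda>a. transfer (gates G x w) w (gedges G ! a)"
  let ?A = "{a. a < length (gedges G) \<and> q (?E a)}"
  \<comment> \<open>\<open>P\<close> pairs backward and forward values node by node,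
    \<open>K\<close> edge by edge. Expanding the forward value in \<open>P\<close> at every node but
    the input gives \<open>K\<close> plus the left side; expanding the backward value at every node
    gives \<open>K\<close> plus the output value.\<close>
  define K where "K = (\<Sum>a\<in>?A. \<Sum>i<gdim G (etgt (?E a)). \<Sum>j<gdim G (esrc (?E a)).
     ?b (etgt (?E a)) i * ?t a j i * ?l (esrc (?E a)) j)"
  define P where "P = (\<Sum>v\<le>gout G. \<Sum>i<gdim G v. ?b v i * ?l v i)"
  have inc: "incoming G q v = {a\<in>?A. etgt (?E a) = v}" for v
    using edge_forward by (auto simp: incoming_def)
  have out: "outgoing q v = {a\<in>?A. esrc (?E a) = v}" for v
    by (auto simp: outgoing_def)
  have tgt: "etgt (?E a) \<in> {1..gout G}" "esrc (?E a) \<le> gout G" if "a \<in> ?A" for a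
    using that edge_forward[of "?E a"] by auto
  have "P = (\<Sum>i<gdim G 0. ?b 0 i * ?l 0 i) + (\<Sum>v\<in>{1..gout G}. \<Sum>i<gdim G v. ?b v i * ?l v i)"
    unfolding P_def atMost_atLeast0 by (subst sum.atLeast_Suc_atMost) auto
  also have "(\<Sum>v\<in>{1..gout G}. \<Sum>i<gdim G v. ?b v i * ?l v i) =
     (\<Sum>v\<in>{1..gout G}. \<Sum>a\<in>{a\<in>?A. etgt (?E a) = v}. \<Sum>i<gdim G (etgt (?E a)). \<Sum>j<gdim G (esrc (?E a)).
     ?b (etgt (?E a)) i * ?t a j i * ?l (esrc (?E a)) j)"
  proof (rule sum.cong[OF refl])
    fix v assume v: "v \<in> {1..gout G}"
    have "(\<Sum>i<gdim G v. ?b v i * ?l v i) = (\<Sum>i<gdim G v. \<Sum>a\<in>{a\<in>?A. etgt (?E a) = v}.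
       \<Sum>j<gdim G (esrc (?E a)). ?b v i * ?t a j i * ?l (esrc (?E a)) j)"
      by (rule sum.cong[OF refl], subst gated_lin_transfer)
        (use v in \<open>auto simp: inc sum_distrib_left mult.assoc\<close>)
    also have "\<dots> = (\<Sum>a\<in>{a\<in>?A. etgt (?E a) = v}. \<Sum>i<gdim G v.
       \<Sum>j<gdim G (esrc (?E a)). ?b v i * ?t a j i * ?l (esrc (?E a)) j)"
      by (rule sum.swap)
    also have "\<dots> = (\<Sum>a\<in>{a\<in>?A. etgt (?E a) = v}. \<Sum>i<gdim G (etgt (?E a)).
       \<Sum>j<gdim G (esrc (?E a)). ?b (etgt (?E a)) i * ?t a j i * ?l (esrc (?E a)) j)"
      by (rule sum.cong[OF refl]) auto
    finally show "(\<Sum>i<gdim G v. ?b v i * ?l v i) = \<dots>" .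
  qed
  also have "\<dots> = K" unfolding K_def by (rule sum.group) (use tgt in auto)
  finally have P1: "P = (\<Sum>i<gdim G 0. ?b 0 i * ?l 0 i) + K" .
  have "P = (\<Sum>v\<le>gout G. (if v = gout G then \<Sum>i<gdim G v. ?l v i else 0) +
     (\<Sum>a\<in>{a\<in>?A. esrc (?E a) = v}. \<Sum>i<gdim G (etgt (?E a)). \<Sum>j<gdim G (esrc (?E a)).
     ?b (etgt (?E a)) i * ?t a j i * ?l (esrc (?E a)) j))"
    unfolding P_def
  proof (rule sum.cong[OF refl])
    fix v
    have "(\<Sum>j<gdim G v. ?b v j * ?l v j) = (\<Sum>j<gdim G v. (if v = gout G then ?l v j else 0) +
       (\<Sum>a\<in>{a\<in>?A. esrc (?E a) = v}.
         \<Sum>i<gdim G (etgt (?E a)). ?b (etgt (?E a)) i * ?t a j i * ?l v j))"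
      by (rule sum.cong[OF refl], subst suffix_sum_rec)
        (simp only: out sum_distrib_right distrib_right,
          intro arg_cong2[where f = "(+)"] sum.cong refl, auto)
    also have "\<dots> = (if v = gout G then \<Sum>j<gdim G v. ?l v j else 0) + 
       (\<Sum>a\<in>{a\<in>?A. esrc (?E a) = v}. \<Sum>j<gdim G v.
         \<Sum>i<gdim G (etgt (?E a)). ?b (etgt (?E a)) i * ?t a j i * ?l v j)"
      unfolding sum.distrib by (subst sum.swap) simp
    also have "\<dots> = (if v = gout G then \<Sum>j<gdim G v. ?l v j else 0) + 
       (\<Sum>a\<in>{a\<in>?A. esrc (?E a) = v}. \<Sum>i<gdim G (etgt (?E a)). \<Sum>j<gdim G (esrc (?E a)).
          ?b (etgt (?E a)) i * ?t a j i * ?l (esrc (?E a)) j)"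
      by (rule arg_cong2[where f = "(+)"], rule refl, rule sum.cong[OF refl], subst sum.swap) auto
    finally show "(\<Sum>j<gdim G v. ?b v j * ?l v j) = \<dots>" .
  qed
  also have "\<dots> = ?l (gout G) 0 + K"
    unfolding sum.distrib K_def by (subst sum.group) (use tgt in \<open>auto simp: out_dim\<close>)
  finally show ?thesis using P1 by (simp add: mult.commute)
qed

text \<open>Avoiding \<open>k\<close> is a condition on each edge separately, so the avoiding paths
  are the paths of a subnetwork; using \<open>k\<close> is not, hence the complement. Both terms
  keep the gates of the full network.\<close>

lemma f_path_eq:
  "f_path G k x w = nval G x w (gout G) 0
     - gated_lin G (\<lambda>e. ekd e \<noteq> Wt k) (gates G x w) x w (gout G) 0"
proof -
  let ?v = "\<lambda>\<gamma>. x (fst \<gamma>) * pvalue x w (fst \<gamma>) (snd \<gamma>)"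
  have paths_eq: "paths G = (SIGMA i:{..<gdim G 0}. suffixes (\<lambda>_. True) 0 i)"
    by (auto simp: paths_def suffixes_def)
  have avoid: "{\<gamma>\<in>paths G. \<not> path_uses G k \<gamma>} =
      (SIGMA i:{..<gdim G 0}. suffixes (\<lambda>e. ekd e \<noteq> Wt k) 0 i)"
    by (fastforce simp: paths_def suffixes_def path_uses_def)
  have fin: "finite (paths G)" unfolding paths_eq by (auto intro!: finite_SigmaI)
  have sums: "sum ?v (SIGMA i:{..<gdim G 0}. suffixes q 0 i) = gated_lin G q (gates G x w) x w (gout G) 0"
    for q
    unfolding path_sum_eq_gated_lin[symmetric] suffix_sum_def sum_distrib_left
    by (subst sum.Sigma) (auto intro!: sum.cong)
  have "f_path G k x w = sum ?v {\<gamma>\<in>paths G. path_uses G k \<gamma>}"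
    by (simp add: f_path_def pvalue_def mult.assoc)
  also have "{\<gamma>\<in>paths G. path_uses G k \<gamma>} = paths G - {\<gamma>\<in>paths G. \<not> path_uses G k \<gamma>}" by auto
  also have "sum ?v \<dots> = sum ?v (paths G) - sum ?v {\<gamma>\<in>paths G. \<not> path_uses G k \<gamma>}"
    by (rule sum_diff) (use fin in auto)
  finally show ?thesis
    unfolding avoid unfolding paths_eq sums nval_eq_gated_lin[of G x w "gout G" 0] .
qed

section \<open>Cutting a network at a weight matrix\<close>

lemma gated_contrib_diff:
  "gated_contrib G w g (\<lambda>u j. S u j - T u j) e i = gated_contrib G w g S e i - gated_contrib G w g T e i"
  by (auto simp: gated_contrib_def right_diff_distrib sum_subtractf split: ekind.split)

lemma gated_contrib_zero:
  assumes "\<And>j. T (esrc e) j = 0"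
  shows "gated_contrib G w g T e i = 0"
  using assms by (auto simp: gated_contrib_def split: ekind.split)

lemma sum_incoming_filter:
  "(\<Sum>a\<in>incoming G q v. f a) = (\<Sum>a\<in>incoming G (\<lambda>_. True) v. if q (gedges G ! a) then f a else (0::real))"
  by (subst sum.inter_filter[symmetric]) (auto simp: incoming_def intro!: sum.cong)

text \<open>In the cut lemma, \<open>none_via\<close> holds nodes that no path reaches through \<open>k\<close>, and \<open>all_via\<close> holds
nodes that every path reaches through \<open>k\<close>. The nodes from \<open>t\<close> on are those where \<open>q\<close> has
removed the connections bypassing \<open>k\<close>.\<close>

lemma gated_lin_cut:
  fixes k q t all_via none_via
  assumes before: "\<And>e. e \<in> set (gedges G) \<Longrightarrow> etgt e < t \<Longrightarrow> q e"
    and none_via: "\<And>e. e \<in> set (gedges G) \<Longrightarrow> etgt e \<in> none_via \<Longrightarrow> esrc e \<in> none_via \<and> ekd e \<noteq> Wt k"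
    and all_via: "\<And>e. e \<in> set (gedges G) \<Longrightarrow> etgt e \<in> all_via \<Longrightarrow> ekd e = Wt k \<or> esrc e \<in> all_via" "0 \<notin> all_via"
    and after: "\<And>e. e \<in> set (gedges G) \<Longrightarrow> t \<le> esrc e \<Longrightarrow> q e \<and> ekd e \<noteq> Wt k"
    and cross: "\<And>e. e \<in> set (gedges G) \<Longrightarrow> esrc e < t \<Longrightarrow> t \<le> etgt e \<Longrightarrow>
      q e \<and> (ekd e = Wt k \<or> esrc e \<in> all_via) \<or> \<not> q e \<and> ekd e \<noteq> Wt k \<and> esrc e \<in> none_via"
    and t: "0 < t" "t \<le> v"
  shows "gated_lin G q (gates G x w) x w v i =
    nval G x w v i - gated_lin G (\<lambda>e. ekd e \<noteq> Wt k) (gates G x w) x w v i"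
proof -
  let ?E = "\<lambda>a. gedges G ! a"
  let ?y = "nval G x w"
  let ?a = "gated_lin G (\<lambda>e. ekd e \<noteq> Wt k) (gates G x w) x w"
  let ?Z = "gated_lin G q (gates G x w) x w"
  have inc: "?E a \<in> set (gedges G)" "etgt (?E a) = v" "esrc (?E a) < v" if "a \<in> incoming G q' v" for a q' v
    using that by (auto simp: incoming_def)
  have Zy: "?Z v i = ?y v i" if "v < t" for v i
    using that
  proof (induction v arbitrary: i rule: less_induct)
    case (less v)
    show ?case
    proof (cases "v = 0")
      case False
      have "incoming G q v = incoming G (\<lambda>_. True) v"
        using before less.prems by (auto simp: incoming_def)
      then show ?thesis using False less
        by (simp add: gated_lin_rec nval_rec) (auto intro!: sum.cong gated_contrib_cong simp: incoming_def)
    qed simp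
  qed
  have ay: "?a v i = ?y v i" if "v \<in> none_via" for v i
    using that
  proof (induction v arbitrary: i rule: less_induct)
    case (less v)
    show ?case
    proof (cases "v = 0")
      case False
      have "incoming G (\<lambda>e. ekd e \<noteq> Wt k) v = incoming G (\<lambda>_. True) v"
        using none_via less.prems by (auto simp: incoming_def)
      moreover have "esrc (?E a) \<in> none_via" if "a \<in> incoming G (\<lambda>_. True) v" for a
        using none_via inc[OF that] less.prems by auto
      ultimately show ?thesis using False less
        by (simp add: gated_lin_rec nval_rec) (auto intro!: sum.cong gated_contrib_cong simp: incoming_def)
    qed simp
  qed
  have a0: "?a v i = 0" if "v \<in> all_via" for v i
    using that
  proof (induction v arbitrary: i rule: less_induct)
    case (less v)
    then have "0 < v" using all_via(2) by (cases v) auto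
    moreover have "?a (esrc (?E a)) j = 0" if "a \<in> incoming G (\<lambda>e. ekd e \<noteq> Wt k) v" for a j
      using less.prems all_via(1)[of "?E a"] inc[OF that] that
      by (intro less.IH) (auto simp: incoming_def)
    ultimately show ?case
      by (auto simp: gated_lin_rec intro!: sum.neutral gated_contrib_zero)
  qed
  show ?thesis using t(2)
  proof (induction v arbitrary: i rule: less_induct)
    case (less v)
    have v: "0 < v" using t less.prems by simp
    have "?y v i - ?a v i = (\<Sum>a\<in>incoming G (\<lambda>_. True) v.
       gated_contrib G w (gates G x w) ?y (?E a) i -
       (if ekd (?E a) \<noteq> Wt k then gated_contrib G w (gates G x w) ?a (?E a) i else 0))"
      unfolding nval_rec[OF v, of G x w i] gated_lin_rec[OF v] sum_incoming_filter[where q = "\<lambda>e. ekd e \<noteq> Wt k"] sum_subtractf ..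
    also have "\<dots> = (\<Sum>a\<in>incoming G (\<lambda>_. True) v.
       if q (?E a) then gated_contrib G w (gates G x w) ?Z (?E a) i else 0)"
    proof (rule sum.cong[OF refl])
      fix a assume a: "a \<in> incoming G (\<lambda>_. True) v"
      note e = inc[OF a]
      let ?gc = "\<lambda>T. gated_contrib G w (gates G x w) T (?E a) i"
      show "?gc ?y - (if ekd (?E a) \<noteq> Wt k then ?gc ?a else 0) = (if q (?E a) then ?gc ?Z else 0)"
      proof (cases "t \<le> esrc (?E a)")
        \<comment> \<open>Beyond the cut both networks keep every edge, and linearity carries the
          difference along.\<close>
        case True
        have "?gc ?Z = ?gc (\<lambda>u j. ?y u j - ?a u j)"
          by (rule gated_contrib_cong) (use less.IH[OF e(3) True] in auto)
        then show ?thesis using after[OF e(1) True] by (simp add: gated_contrib_diff)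
      next
        \<comment> \<open>A kept edge across the cut carries \<open>k\<close>, so that the avoiding
          network lacks it, or starts where the avoiding network is 0; either way the full value
          remains. A removed edge starts where the two networks agree, and their contributions
          cancel.\<close>
        case False
        then have s: "esrc (?E a) < t" by simp
        have Z: "?gc ?Z = ?gc ?y" by (rule gated_contrib_cong) (use Zy s in auto)
        have "?gc ?a = 0" if "esrc (?E a) \<in> all_via" by (rule gated_contrib_zero) (use a0 that in auto)
        moreover have "?gc ?a = ?gc ?y" if "esrc (?E a) \<in> none_via" by (rule gated_contrib_cong) (use ay that in auto)
        ultimately show ?thesis using cross[OF e(1) s] less.prems e(2) Z by auto
      qed
    qed
    also have "\<dots> = ?Z v i" unfolding gated_lin_rec[OF v] sum_incoming_filter[where q = q] ..
    finally show ?case ..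
  qed
qed

end

section \<open>Sign flips\<close>

abbreviation gauss :: "real measure" where
  "gauss \<equiv> density lborel (\<lambda>x. ennreal (std_normal_density x))"

lemma prob_space_gauss: "prob_space gauss"
  by (rule prob_space_normal_density) simp

lemma product_sigma_finite_gauss: "product_sigma_finite (\<lambda>_. gauss)"
  using prob_space_gauss
  by (simp add: product_sigma_finite_def prob_space_imp_sigma_finite)

text \<open>The normal density is even and Lebesgue measure is invariant under negation.\<close>

lemma emeasure_gauss_vimage_sign:
  assumes "s \<in> {-1, 1::real}" "A \<in> sets borel"
  shows "emeasure gauss ((\<lambda>t. s * t) -` A) = emeasure gauss A"
proof (cases "s = 1")
  case False
  then have s: "s = -1" using assms by auto
  have [measurable]: "A \<in> sets borel" by fact
  have "uminus -` A \<inter> space borel \<in> sets borel"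
    by (rule measurable_sets[of _ borel borel]) auto
  then have [measurable]: "uminus -` A \<in> sets borel" by simp
  have "emeasure gauss A = (\<integral>\<^sup>+t. ennreal (std_normal_density t) * indicator A t \<partial>distr lborel borel uminus)"
    by (simp add: emeasure_density lborel_distr_uminus)
  also have "\<dots> = (\<integral>\<^sup>+t. ennreal (std_normal_density (-t)) * indicator A (-t) \<partial>lborel)"
    by (subst nn_integral_distr) auto
  also have "\<dots> = (\<integral>\<^sup>+t. ennreal (std_normal_density t) * indicator (uminus -` A) t \<partial>lborel)"
    by (intro nn_integral_cong) (auto simp: std_normal_density_def indicator_def)
  also have "\<dots> = emeasure gauss (uminus -` A)"
    by (simp add: emeasure_density)
  finally show ?thesis using s by simp
qed simp

text \<open>Boxes determine the product measure, and each factor is symmetric. Coordinates outside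
  \<open>I\<close> need sign 1 because points of the product space are \<open>undefined\<close>
  there.\<close>

lemma distr_PiM_gauss_signs:
  fixes \<tau> :: "'i \<Rightarrow> real"
  assumes "finite I" "\<And>p. \<tau> p \<in> {-1, 1}" "\<And>p. p \<notin> I \<Longrightarrow> \<tau> p = 1"
  shows "(\<lambda>w p. \<tau> p * w p) \<in> PiM I (\<lambda>_. gauss) \<rightarrow>\<^sub>M PiM I (\<lambda>_. gauss)"
    and "distr (PiM I (\<lambda>_. gauss)) (PiM I (\<lambda>_. gauss)) (\<lambda>w p. \<tau> p * w p) = PiM I (\<lambda>_. gauss)"
proof -
  interpret product_sigma_finite "\<lambda>_::'i. gauss" by (rule product_sigma_finite_gauss)
  let ?M = "PiM I (\<lambda>_. gauss)"
  let ?f = "\<lambda>w p. \<tau> p * w p"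
  show meas: "?f \<in> ?M \<rightarrow>\<^sub>M ?M"
  proof (rule measurable_PiM_single')
    fix p assume p: "p \<in> I"
    have "(\<lambda>w. w p) \<in> ?M \<rightarrow>\<^sub>M gauss" by (rule measurable_component_singleton[OF p])
    then show "(\<lambda>w. \<tau> p * w p) \<in> ?M \<rightarrow>\<^sub>M gauss" by simp
  next
    show "?f \<in> space ?M \<rightarrow> (\<Pi>\<^sub>E p\<in>I. space gauss)"
      using assms(3) by (auto simp: space_PiM PiE_def extensional_def)
  qed
  show "distr ?M ?M ?f = ?M"
  proof (rule PiM_eqI)
    fix A :: "'i \<Rightarrow> real set" assume A: "\<And>p. p \<in> I \<Longrightarrow> A p \<in> sets gauss"
    have S: "(\<lambda>t. \<tau> p * t) -` A p \<in> sets gauss" if "p \<in> I" for p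
      using measurable_sets[of "\<lambda>t. \<tau> p * t" borel borel "A p"] A[OF that] by simp
    have "emeasure (distr ?M ?M ?f) (Pi\<^sub>E I A) = emeasure ?M (?f -` (Pi\<^sub>E I A) \<inter> space ?M)"
      using A assms(1) by (intro emeasure_distr meas sets_PiM_I_finite) auto
    also have "?f -` (Pi\<^sub>E I A) \<inter> space ?M = (\<Pi>\<^sub>E p\<in>I. (\<lambda>t. \<tau> p * t) -` A p)"
      using assms(3) by (auto simp: space_PiM PiE_def extensional_def Pi_def)
    also have "emeasure ?M \<dots> = (\<Prod>p\<in>I. emeasure gauss ((\<lambda>t. \<tau> p * t) -` A p))"
      using S assms(1) by (intro emeasure_PiM) auto
    also have "\<dots> = (\<Prod>p\<in>I. emeasure gauss (A p))"
      using A assms(2) by (intro prod.cong refl emeasure_gauss_vimage_sign) auto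
    finally show "emeasure (distr ?M ?M ?f) (Pi\<^sub>E I A) = (\<Prod>p\<in>I. emeasure gauss (A p))" .
  qed (use assms(1) in auto)
qed

text \<open>Fubini in the coordinate \<open>p\<close>: with the other coordinates fixed,
  \<open>a\<close> and \<open>b\<close> are constants, the only root is \<open>- b w / a w\<close>,
  and the normal distribution has no atoms.\<close>

lemma AE_PiM_gauss_affine_nonzero:
  fixes a b :: "('i \<Rightarrow> real) \<Rightarrow> real"
  assumes I: "finite I" "p \<in> I"
    and [measurable]: "a \<in> borel_measurable (PiM I (\<lambda>_. gauss))" "b \<in> borel_measurable (PiM I (\<lambda>_. gauss))"
    and a: "\<And>w t. a (w(p := t)) = a w" and b: "\<And>w t. b (w(p := t)) = b w"
  shows "AE w in PiM I (\<lambda>_. gauss). a w \<noteq> 0 \<longrightarrow> w p * a w + b w \<noteq> 0"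
proof -
  interpret product_sigma_finite "\<lambda>_::'i. gauss" by (rule product_sigma_finite_gauss)
  let ?M = "PiM I (\<lambda>_. gauss)"
  have Ip: "I = insert p (I - {p})" using I by auto
  have "(\<lambda>w. w p) \<in> ?M \<rightarrow>\<^sub>M gauss" by (rule measurable_component_singleton[OF I(2)])
  then have [measurable]: "(\<lambda>w. w p) \<in> borel_measurable ?M" by simp
  define S where "S = {w \<in> space ?M. a w \<noteq> 0 \<and> w p * a w + b w = 0}"
  have S[measurable]: "S \<in> sets ?M" unfolding S_def by measurable
  have null: "emeasure gauss {c} = 0" for c :: real
  proof -
    have "(\<lambda>x. ennreal (std_normal_density x) * indicator {c} x) = (\<lambda>x. ennreal (std_normal_density c) * indicator {c} x)"
      by (auto simp: indicator_def fun_eq_iff)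
    then show ?thesis by (simp add: emeasure_density nn_integral_cmult)
  qed
  have inner: "(\<integral>\<^sup>+t. indicator S (w(p := t)) \<partial>gauss) = 0" for w
  proof -
    have "(\<integral>\<^sup>+t. indicator S (w(p := t)) \<partial>gauss) \<le> (\<integral>\<^sup>+t. indicator {- b w / a w} t \<partial>gauss)"
      by (intro nn_integral_mono) (auto simp: indicator_def S_def a b field_simps eq_neg_iff_add_eq_0)
    also have "\<dots> = emeasure gauss {- b w / a w}" by (rule nn_integral_indicator) simp
    finally show ?thesis using null by simp
  qed
  have "emeasure ?M S = (\<integral>\<^sup>+w. indicator S w \<partial>?M)" by simp
  also have "\<dots> = (\<integral>\<^sup>+w. (\<integral>\<^sup>+t. indicator S (w(p := t)) \<partial>gauss) \<partial>PiM (I - {p}) (\<lambda>_. gauss))"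
    using S I(1) Ip by (subst (1) Ip, subst product_nn_integral_insert) (auto simp flip: Ip)
  also have "\<dots> = 0" by (simp add: inner)
  finally have "S \<in> null_sets ?M" using S by auto
  then show ?thesis
    by (rule AE_I') (auto simp: S_def)
qed

context feedforward
begin

section \<open>The sign group acting on the weights\<close>

lemma finite_wset: "finite (wset G)"
proof -
  \<comment> \<open>\<open>MIn\<close> is a filler for identity edges; no element of
    \<open>wset G\<close> comes from one.\<close>
  have "wset G \<subseteq> (\<Union>e\<in>set (gedges G). (\<lambda>(i, j). (case ekd e of Wt k \<Rightarrow> k | Ident \<Rightarrow> MIn, i, j)) `
      ({..<gdim G (etgt e)} \<times> {..<gdim G (esrc e)}))"
    by (force simp: wset_def)
  then show ?thesis by (rule finite_subset) auto
qed

lemma wset_I: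
  "\<lbrakk>e \<in> set (gedges G); ekd e = Wt k; i < gdim G (etgt e); j < gdim G (esrc e)\<rbrakk> \<Longrightarrow> (k, i, j) \<in> wset G"
  by (auto simp: wset_def)

lemma weight_measurable:
  "p \<in> wset G \<Longrightarrow> (\<lambda>w. w p) \<in> borel_measurable (wmeasure G)"
  using measurable_component_singleton[of p "wset G" "\<lambda>_. gauss"] by (simp add: wmeasure_def)

definition key_edge :: "mkey \<Rightarrow> edge" where
  "key_edge k = (THE e. e \<in> set (gedges G) \<and> ekd e = Wt k)"

lemma key_edge_eq: "\<lbrakk>e \<in> set (gedges G); ekd e = Wt k\<rbrakk> \<Longrightarrow> key_edge k = e"
  unfolding key_edge_def using key_unique by blast

definition active_nodes :: "nat set" where
  "active_nodes = esrc ` {e \<in> set (gedges G). eact e}"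

definition gated_units :: "(nat \<times> nat) set" where
  "gated_units = (SIGMA v:active_nodes. {..<gdim G v})"

text \<open>A finite group isomorphic to a power of {-1, 1}. The value 1 off the gated units leaves
  the input, the output and the ends of identity edges without flips.\<close>

definition signs :: "(nat \<times> nat \<Rightarrow> real) set" where
  "signs = {s. \<forall>p. (p \<in> gated_units \<longrightarrow> s p \<in> {-1, 1}) \<and> (p \<notin> gated_units \<longrightarrow> s p = 1)}"

text \<open>A gauge transformation: a weight takes the signs of the units at both of its ends. The
  factor 1 outside \<open>wset G\<close> is what \<open>distr_PiM_gauss_signs\<close> asks
  for.\<close>

definition flip_sign :: "(nat \<times> nat \<Rightarrow> real) \<Rightarrow> mkey \<times> nat \<times> nat \<Rightarrow> real" where
  "flip_sign s = (\<lambda>(k, i, j). if (k, i, j) \<in> wset G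
     then s (etgt (key_edge k), i) * s (esrc (key_edge k), j) else 1)"

definition flip :: "(nat \<times> nat \<Rightarrow> real) \<Rightarrow> weights \<Rightarrow> weights" where
  "flip s w = (\<lambda>p. flip_sign s p * w p)"

lemma finite_signs: "finite signs"
  unfolding signs_def
  by (rule finite_set_of_finite_funs) (auto simp: gated_units_def active_nodes_def)

lemma signs_range: "s \<in> signs \<Longrightarrow> s p \<in> {-1, 1}"
  unfolding signs_def by blast

lemma mult_signs: "s \<in> signs \<Longrightarrow> t \<in> signs \<Longrightarrow> s p * t p' \<in> {-1, 1}"
  using signs_range[of s p] signs_range[of t p'] by auto

lemma signs_square: "s \<in> signs \<Longrightarrow> s p * s p = 1"
  using signs_range[of s p] by auto

lemma signs_mult: "s \<in> signs \<Longrightarrow> t \<in> signs \<Longrightarrow> (\<lambda>p. s p * t p) \<in> signs"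
  unfolding signs_def by (clarify, rename_tac v i, drule_tac x = "(v, i)" in spec, drule_tac x = "(v, i)" in spec) auto

lemma signs_one: "(\<lambda>_. 1) \<in> signs"
  by (auto simp: signs_def)

lemma signs_eq_1: "s \<in> signs \<Longrightarrow> v \<notin> active_nodes \<Longrightarrow> s (v, i) = 1"
  by (auto simp: signs_def gated_units_def)

lemma zero_not_active: "0 \<notin> active_nodes"
  using active_source by (fastforce simp: active_nodes_def)

lemma flip_flip: "flip s (flip t w) = flip (\<lambda>p. s p * t p) w"
  by (auto simp: flip_def flip_sign_def fun_eq_iff)

lemma flip_measure_preserving:
  assumes "s \<in> signs"
  shows "flip s \<in> wmeasure G \<rightarrow>\<^sub>M wmeasure G" "distr (wmeasure G) (wmeasure G) (flip s) = wmeasure G"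
proof -
  have *: "flip_sign s p \<in> {-1, 1}" "p \<notin> wset G \<Longrightarrow> flip_sign s p = 1" for p
    using mult_signs[OF assms assms] by (auto simp: flip_sign_def split: prod.split)
  show "flip s \<in> wmeasure G \<rightarrow>\<^sub>M wmeasure G" "distr (wmeasure G) (wmeasure G) (flip s) = wmeasure G"
    unfolding wmeasure_def flip_def[abs_def]
    by (intro distr_PiM_gauss_signs finite_wset *; assumption)+
qed

text \<open>The sign of the source unit occurs twice, in the flipped weight and in the source value,
  and cancels; the sign of the target remains. The two sides may have different gates and values,
  which covers both one network before and after a flip and the reduced network against the linear
  one.\<close>

lemma gated_contrib_flip:
  assumes e: "e \<in> set (gedges G)" and i: "i < gdim G (etgt e)" and s: "s \<in> signs"
    and H: "\<And>j. j < gdim G (esrc e) \<Longrightarrow>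
      gate_factor g' e j * T' (esrc e) j = s (esrc e, j) * (gate_factor g e j * T (esrc e) j)"
  shows "gated_contrib G (flip s w) g' T' e i = s (etgt e, i) * gated_contrib G w g T e i"
proof (cases "ekd e")
  case Ident
  have "esrc e \<notin> active_nodes" "etgt e \<notin> active_nodes"
    using active_source_ident e Ident by (fastforce simp: active_nodes_def)+
  then show ?thesis
    using signs_eq_1[OF s] H[of i] i ident_edge[OF e Ident] by (simp add: gated_contrib_def Ident)
next
  case (Wt k)
  have "(\<Sum>j<gdim G (esrc e). flip s w (k, i, j) * (gate_factor g' e j * T' (esrc e) j)) =
     (\<Sum>j<gdim G (esrc e). s (etgt e, i) * (w (k, i, j) * (gate_factor g e j * T (esrc e) j)))"
  proof (rule sum.cong[OF refl])
    fix j assume "j \<in> {..<gdim G (esrc e)}"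
    then have j: "j < gdim G (esrc e)" by simp
    have "flip s w (k, i, j) * (gate_factor g' e j * T' (esrc e) j) =
       (s (esrc e, j) * s (esrc e, j)) * (s (etgt e, i) * (w (k, i, j) * (gate_factor g e j * T (esrc e) j)))"
      unfolding H[OF j] flip_def flip_sign_def
      using wset_I[OF e Wt i j] key_edge_eq[OF e Wt] by (simp add: mult_ac)
    then show "flip s w (k, i, j) * (gate_factor g' e j * T' (esrc e) j) =
       s (etgt e, i) * (w (k, i, j) * (gate_factor g e j * T (esrc e) j))"
      using signs_square[OF s] by simp
  qed
  then show ?thesis by (simp add: gated_contrib_def Wt sum_distrib_left mult_ac)
qed

lemma flip_below:
  assumes "s \<in> signs" "\<And>u j. u < v \<Longrightarrow> s (u, j) = 1"
    and "e \<in> set (gedges G)" "etgt e < v" "ekd e = Wt k"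
  shows "flip s w (k, i, j) = w (k, i, j)"
  using assms key_edge_eq[OF assms(3,5)] edge_forward[OF assms(3)]
  by (auto simp: flip_def flip_sign_def)

lemma nval_flip_below:
  assumes "s \<in> signs" "\<And>u j. u < v \<Longrightarrow> s (u, j) = 1" "u < v"
  shows "nval G x (flip s w) u j = nval G x w u j"
  by (rule nval_cong, rule flip_below[OF assms(1,2)]) (use assms(3) in auto)

lemma nval_flip_first:
  assumes s: "s \<in> signs" "\<And>u j. u < v \<Longrightarrow> s (u, j) = 1" and i: "i < gdim G v"
  shows "nval G x (flip s w) v i = s (v, i) * nval G x w v i"
proof (cases "v = 0")
  case True
  then show ?thesis using signs_eq_1[OF s(1) zero_not_active] by simp
next
  case False
  then have v: "0 < v" by simp
  note below = nval_flip_below[OF s]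
  show ?thesis unfolding nval_rec[OF v] sum_distrib_left
  proof (rule sum.cong[OF refl])
    fix a assume a: "a \<in> incoming G (\<lambda>_. True) v"
    show "gated_contrib G (flip s w) (gates G x (flip s w)) (nval G x (flip s w)) (gedges G ! a) i =
      s (v, i) * gated_contrib G w (gates G x w) (nval G x w) (gedges G ! a) i"
      using a i s below gated_contrib_flip[of "gedges G ! a" i s "gates G x (flip s w)" "nval G x (flip s w)" "gates G x w" "nval G x w" w]
      by (auto simp: incoming_def gate_factor_def)
  qed
qed

lemma gated_lin_flip_below:
  assumes "s \<in> signs" "\<And>u j. u < v \<Longrightarrow> s (u, j) = 1" "u < v"
  shows "gated_lin G q (gates G x (flip s w)) x (flip s w) u j = gated_lin G q (gates G x w) x w u j"
proof (rule gated_lin_cong)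
  fix e k i j assume "e \<in> set (gedges G)" "etgt e \<le> u" "ekd e = Wt k"
  then show "flip s w (k, i, j) = w (k, i, j)"
    using assms(3) by (intro flip_below[OF assms(1,2)]) auto
next
  fix u' j assume "u' < u"
  then show "(0 < nval G x (flip s w) u' j) = (0 < nval G x w u' j)"
    using nval_flip_below[OF assms(1,2), where u = u'] assms(3) by simp
qed

lemma gated_lin_flip_first:
  assumes s: "s \<in> signs" "\<And>u j. u < v \<Longrightarrow> s (u, j) = 1" and i: "i < gdim G v"
  shows "gated_lin G q (gates G x (flip s w)) x (flip s w) v i =
    s (v, i) * gated_lin G q (gates G x w) x w v i"
proof (cases "v = 0")
  case True
  then show ?thesis using signs_eq_1[OF s(1) zero_not_active] by simp
next
  case False
  then have v: "0 < v" by simp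
  note below = gated_lin_flip_below[OF s] nval_flip_below[OF s]
  show ?thesis unfolding gated_lin_rec[OF v] sum_distrib_left
  proof (rule sum.cong[OF refl])
    fix a assume a: "a \<in> incoming G q v"
    show "gated_contrib G (flip s w) (gates G x (flip s w)) (gated_lin G q (gates G x (flip s w)) x (flip s w)) (gedges G ! a) i =
      s (v, i) * gated_contrib G w (gates G x w) (gated_lin G q (gates G x w) x w) (gedges G ! a) i"
      using a i s below gated_contrib_flip[of "gedges G ! a" i s "gates G x (flip s w)"
          "gated_lin G q (gates G x (flip s w)) x (flip s w)" "gates G x w" "gated_lin G q (gates G x w) x w" w]
      by (auto simp: incoming_def gate_factor_def)
  qed
qed

section \<open>Aligning the reduced network with the gates of the full network\<close>

definition align :: "(edge \<Rightarrow> bool) \<Rightarrow> (nat \<Rightarrow> real) \<Rightarrow> weights \<Rightarrow> nat \<times> nat \<Rightarrow> real" where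
  "align q x w = (\<lambda>(v, i). if (v, i) \<in> gated_units \<and>
     gated_lin G q (gates G x w) x w v i * nval G x w v i < 0 then -1 else 1)"

lemma align_signs: "align q x w \<in> signs"
  by (auto simp: align_def signs_def)

text \<open>A tie means y = 0 and z nonzero. The gate of the full network is then closed, but the
  aligning sign is 1, and for z > 0 the reduced network would open its gate.\<close>

definition no_tie :: "(edge \<Rightarrow> bool) \<Rightarrow> (nat \<Rightarrow> real) \<Rightarrow> weights \<Rightarrow> bool" where
  "no_tie q x w \<longleftrightarrow> (\<forall>(v, i)\<in>gated_units.
     nval G x w v i = 0 \<longrightarrow> gated_lin G q (gates G x w) x w v i = 0)"

lemma nval_subnet_flip_align:
  assumes "no_tie q x w" "i < gdim G v"
  shows "nval (subnet G q) x (flip (align q x w) w) v i =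
    align q x w (v, i) * gated_lin G q (gates G x w) x w v i"
  using assms(2)
proof (induction v arbitrary: i rule: less_induct)
  case (less v)
  let ?s = "align q x w"
  let ?Z = "gated_lin G q (gates G x w) x w"
  let ?r = "nval (subnet G q) x (flip ?s w)"
  show ?case
  proof (cases "v = 0")
    case True
    then show ?thesis using signs_eq_1[OF align_signs zero_not_active] by simp
  next
    case False
    then have v: "0 < v" by simp
    show ?thesis unfolding nval_subnet_rec[OF v] gated_lin_rec[OF v] sum_distrib_left
    proof (rule sum.cong[OF refl])
      fix a assume a: "a \<in> incoming G q v"
      let ?e = "gedges G ! a"
      have e: "?e \<in> set (gedges G)" "etgt ?e = v" "esrc ?e < v" using a by (auto simp: incoming_def)
      have "gated_contrib G (flip ?s w) (gates (subnet G q) x (flip ?s w)) ?r ?e i =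
        ?s (etgt ?e, i) * gated_contrib G w (gates G x w) ?Z ?e i"
      proof (rule gated_contrib_flip[OF e(1) _ align_signs])
        show "i < gdim G (etgt ?e)" using e less.prems by simp
        fix j assume j: "j < gdim G (esrc ?e)"
        let ?u = "esrc ?e"
        have r: "?r ?u j = ?s (?u, j) * ?Z ?u j" by (rule less.IH[OF e(3) j])
        show "gate_factor (gates (subnet G q) x (flip ?s w)) ?e j * ?r ?u j =
          ?s (?u, j) * (gate_factor (gates G x w) ?e j * ?Z ?u j)"
        proof (cases "eact ?e")
          case True
          then have D: "(?u, j) \<in> gated_units"
            using e(1) j by (auto simp: gated_units_def active_nodes_def)
          then have tie: "nval G x w ?u j = 0 \<longrightarrow> ?Z ?u j = 0"
            using assms(1) by (auto simp: no_tie_def)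
          have s: "?s (?u, j) = (if ?Z ?u j * nval G x w ?u j < 0 then -1 else 1)"
            using D by (simp add: align_def)
          \<comment> \<open>For y > 0 the aligned value is the absolute value of z: the reduced gate
            is open unless z = 0, and then both sides are 0. For y < 0 it is minus that absolute
            value, and both gates are closed. For y = 0 the absence of ties gives z = 0.\<close>
          show ?thesis unfolding gate_factor_def r s using True tie
            by (auto simp: mult_less_0_iff zero_less_mult_iff not_less)
        qed (simp add: gate_factor_def r)
      qed
      then show "gated_contrib G (flip ?s w) (gates (subnet G q) x (flip ?s w)) ?r ?e i =
        ?s (v, i) * gated_contrib G w (gates G x w) ?Z ?e i" using e(2) by simp
    qed
  qed
qed

text \<open>Flipping the rows into unit \<open>(v, i)\<close> negates both preactivations compared by \<^const>\<open>align\<close>,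
so \<open>align (flip s w) (v, i)\<close> depends only on the signs \<open>s\<close> at nodes before \<open>v\<close>: the map is triangular.\<close>

lemma align_bij:
  "bij_betw (\<lambda>s p. align q x (flip s w) p * s p) signs signs"
proof -
  let ?f = "\<lambda>s p. align q x (flip s w) p * s p"
  have "inj_on ?f signs"
  proof (rule inj_onI)
    fix s t assume s: "s \<in> signs" and t: "t \<in> signs" and eq: "?f s = ?f t"
    \<comment> \<open>The quotient of \<open>s\<close> and \<open>t\<close>, signs being their own
      inverses. Where it is 1 before \<open>v\<close>, it multiplies both preactivations at
      \<open>v\<close> by the same sign; the aligning signs there agree and cancel from
      \<open>eq\<close>, so it is 1 at \<open>v\<close> too.\<close>
    define \<rho> where "\<rho> = (\<lambda>p. t p * s p)"
    have \<rho>: "\<rho> \<in> signs" unfolding \<rho>_def by (rule signs_mult[OF t s])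
    have "(\<lambda>p. \<rho> p * s p) = t"
      using signs_square[OF s] by (simp add: \<rho>_def mult.assoc fun_eq_iff)
    then have ft: "flip t w = flip \<rho> (flip s w)" by (simp add: flip_flip)
    have "\<rho> (v, i) = 1" for v i
    proof (induction v arbitrary: i rule: less_induct)
      case (less v)
      show ?case
      proof (cases "(v, i) \<in> gated_units")
        case False
        then show ?thesis using \<rho> by (auto simp: signs_def)
      next
        case True
        then have i: "i < gdim G v" by (auto simp: gated_units_def)
        let ?u = "flip s w"
        have "gated_lin G q (gates G x (flip \<rho> ?u)) x (flip \<rho> ?u) v i * nval G x (flip \<rho> ?u) v i =
          (\<rho> (v, i) * \<rho> (v, i)) * (gated_lin G q (gates G x ?u) x ?u v i * nval G x ?u v i)"
          by (simp only: nval_flip_first[OF \<rho> less.IH i] gated_lin_flip_first[OF \<rho> less.IH i] mult_ac)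
        then have "align q x (flip t w) (v, i) = align q x (flip s w) (v, i)"
          unfolding ft by (simp add: align_def signs_square[OF \<rho>])
        moreover have "align q x (flip s w) (v, i) \<noteq> 0"
          using signs_range[OF align_signs, of q x "flip s w" "(v, i)"] by auto
        ultimately have "s (v, i) = t (v, i)"
          using fun_cong[OF eq, of "(v, i)"] by simp
        then show ?thesis using signs_square[OF t] by (simp add: \<rho>_def)
      qed
    qed
    then have "t p * s p = 1" for p by (cases p) (simp add: \<rho>_def)
    then have "s p = t p" for p using signs_range[OF s, of p] signs_range[OF t, of p]
      by (metis insertE mult_1 mult_minus1 one_neq_neg_one singletonD minus_minus)
    then show "s = t" by (simp add: fun_eq_iff)
  qed
  moreover have "?f ` signs \<subseteq> signs" using signs_mult[OF align_signs] by auto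
  ultimately show ?thesis
    using endo_inj_surj[OF finite_signs] by (simp add: bij_betw_def)
qed

section \<open>Measurability of node values\<close>

lemma gated_contrib_measurable:
  assumes e: "e \<in> set (gedges G)" and i: "i < gdim G (etgt e)"
    and T: "\<And>j. j < gdim G (esrc e) \<Longrightarrow> (\<lambda>w. T w (esrc e) j) \<in> borel_measurable (wmeasure G)"
    and S: "\<And>j. j < gdim G (esrc e) \<Longrightarrow> (\<lambda>w. S w (esrc e) j) \<in> borel_measurable (wmeasure G)"
  shows "(\<lambda>w. gated_contrib G w (\<lambda>u j. 0 < (S w u j :: real)) (T w) e i) \<in> borel_measurable (wmeasure G)"
proof -
  have gf: "(\<lambda>w. gate_factor (\<lambda>u j. 0 < S w u j) e j * T w (esrc e) j) \<in> borel_measurable (wmeasure G)"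
    if "j < gdim G (esrc e)" for j
  proof -
    note [measurable] = T[OF that] S[OF that]
    show ?thesis unfolding gate_factor_def by measurable
  qed
  show ?thesis
  proof (cases "ekd e")
    case Ident
    then show ?thesis using gf[of i] i ident_edge[OF e Ident]
      by (simp add: gated_contrib_def)
  next
    case (Wt k)
    have "(\<lambda>w. w (k, i, j) * (gate_factor (\<lambda>u j. 0 < S w u j) e j * T w (esrc e) j)) \<in> borel_measurable (wmeasure G)"
      if "j < gdim G (esrc e)" for j
      by (intro borel_measurable_times weight_measurable wset_I[OF e Wt i that] gf that)
    then show ?thesis using Wt by (auto simp: gated_contrib_def)
  qed
qed

lemma nval_subnet_measurable:
  "i < gdim G v \<Longrightarrow> (\<lambda>w. nval (subnet G q) x w v i) \<in> borel_measurable (wmeasure G)"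
proof (induction v arbitrary: i rule: less_induct)
  case (less v)
  show ?case
  proof (cases "v = 0")
    case False
    then have v: "0 < v" by simp
    show ?thesis unfolding nval_subnet_rec[OF v]
      by (intro borel_measurable_sum gated_contrib_measurable)
        (use less in \<open>auto simp: incoming_def\<close>)
  qed simp
qed

lemma nval_measurable:
  "i < gdim G v \<Longrightarrow> (\<lambda>w. nval G x w v i) \<in> borel_measurable (wmeasure G)"
  by (rule nval_subnet_measurable[where q = "\<lambda>_. True", unfolded subnet_all])

lemma gated_lin_measurable:
  "i < gdim G v \<Longrightarrow> (\<lambda>w. gated_lin G q (gates G x w) x w v i) \<in> borel_measurable (wmeasure G)"
proof (induction v arbitrary: i rule: less_induct)
  case (less v)
  show ?case
  proof (cases "v = 0")
    case False
    then have v: "0 < v" by simp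
    show ?thesis unfolding gated_lin_rec[OF v]
      by (intro borel_measurable_sum gated_contrib_measurable nval_measurable)
        (use less in \<open>auto simp: incoming_def\<close>)
  qed simp
qed

section \<open>Values as affine functions of one weight, and the null set of ties\<close>

lemma nval_upd_below:
  assumes "e \<in> set (gedges G)" "ekd e = Wt k" "u < etgt e"
  shows "nval G x (w((k, i, j) := t)) u l = nval G x w u l"
proof (rule nval_cong)
  fix e' k' i' j' assume e': "e' \<in> set (gedges G)" "etgt e' \<le> u" "ekd e' = Wt k'"
  then have "k' \<noteq> k" using assms key_unique[OF e'(1) assms(1) e'(3)] by auto
  then show "(w((k, i, j) := t)) (k', i', j') = w (k', i', j')" by simp
qed

lemma gates_upd_below:
  assumes "e \<in> set (gedges G)" "ekd e = Wt k"
  shows "gate_factor (gates G x (w((k, i, j) := t))) e l = gate_factor (gates G x w) e l"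
  using nval_upd_below[OF assms] edge_forward[OF assms(1)] by (simp add: gate_factor_def)

text \<open>The card makes the distinctness of the edge list irrelevant.\<close>

definition edge_weight :: "edge \<Rightarrow> real" where
  "edge_weight e = real (card {a \<in> incoming G (\<lambda>_. True) (etgt e). gedges G ! a = e}) * ecoef e"

lemma edge_weight_pos:
  assumes "e \<in> set (gedges G)"
  shows "0 < edge_weight e"
proof -
  obtain a where "a < length (gedges G)" "gedges G ! a = e" using assms by (auto simp: in_set_conv_nth)
  then have "a \<in> {a \<in> incoming G (\<lambda>_. True) (etgt e). gedges G ! a = e}"
    using edge_forward[OF assms] by (auto simp: incoming_def)
  then have "card {a \<in> incoming G (\<lambda>_. True) (etgt e). gedges G ! a = e} > 0"
    by (subst card_gt_0_iff) auto
  then show ?thesis using ecoef_pos[OF assms] by (simp add: edge_weight_def)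
qed

text \<open>By \<open>key_unique\<close> the entry enters only through the copies of
  \<open>e\<close>. The slope is made of values at the source of \<open>e\<close>, which precedes
  every use of the entry, so it does not depend on the entry.\<close>

lemma nval_affine:
  assumes e: "e \<in> set (gedges G)" "ekd e = Wt k" and j: "j < gdim G (esrc e)"
  shows "nval G x w (etgt e) i =
    w (k, i, j) * (edge_weight e * (gate_factor (gates G x w) e j * nval G x w (esrc e) j))
      + nval G x (w((k, i, j) := 0)) (etgt e) i"
proof -
  let ?w = "w((k, i, j) := 0)"
  let ?c = "w (k, i, j) * (ecoef e * (gate_factor (gates G x w) e j * nval G x w (esrc e) j))"
  have v: "0 < etgt e" using edge_forward[OF e(1)] by simp
  have "nval G x w (etgt e) i = (\<Sum>a\<in>incoming G (\<lambda>_. True) (etgt e).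
      (if gedges G ! a = e then ?c else 0) + gated_contrib G ?w (gates G x ?w) (nval G x ?w) (gedges G ! a) i)"
    unfolding nval_rec[OF v, of G x w i]
  proof (rule sum.cong[OF refl])
    fix a assume a: "a \<in> incoming G (\<lambda>_. True) (etgt e)"
    let ?e = "gedges G ! a"
    have e': "?e \<in> set (gedges G)" "esrc ?e < etgt e" using a by (auto simp: incoming_def)
    have below: "nval G x ?w (esrc ?e) l = nval G x w (esrc ?e) l" for l
      by (rule nval_upd_below[OF e e'(2)])
    have swap: "gated_contrib G ?w (gates G x ?w) (nval G x ?w) ?e i = gated_contrib G ?w (gates G x w) (nval G x w) ?e i"
      by (rule gated_contrib_cong) (simp_all add: below)
    show "gated_contrib G w (gates G x w) (nval G x w) ?e i = (if ?e = e then ?c else 0)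
        + gated_contrib G ?w (gates G x ?w) (nval G x ?w) ?e i"
    proof (cases "?e = e")
      case False
      have "gated_contrib G ?w (gates G x w) (nval G x w) ?e i = gated_contrib G w (gates G x w) (nval G x w) ?e i"
        by (rule gated_contrib_cong) (use False key_unique[OF e'(1) e(1) _ e(2)] in auto)
      then show ?thesis using False swap by simp
    next
      case True
      let ?T = "\<lambda>l. gate_factor (gates G x w) e l * nval G x w (esrc e) l"
      have "(\<Sum>l<gdim G (esrc e). w (k, i, l) * ?T l) = w (k, i, j) * ?T j
          + (\<Sum>l\<in>{..<gdim G (esrc e)} - {j}. w (k, i, l) * ?T l)"
        using j by (subst sum.remove[of _ j]) auto
      moreover have "(\<Sum>l<gdim G (esrc e). ?w (k, i, l) * ?T l) = 
          (\<Sum>l\<in>{..<gdim G (esrc e)} - {j}. w (k, i, l) * ?T l)"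
        using j by (subst sum.remove[of _ j]) (auto intro!: sum.cong)
      ultimately have "(\<Sum>l<gdim G (esrc e). w (k, i, l) * ?T l) =
          w (k, i, j) * ?T j + (\<Sum>l<gdim G (esrc e). ?w (k, i, l) * ?T l)" by simp
      then show ?thesis unfolding swap
        using True by (simp add: gated_contrib_def e(2) distrib_left mult_ac)
    qed
  qed
  also have "\<dots> = (\<Sum>a\<in>incoming G (\<lambda>_. True) (etgt e). if gedges G ! a = e then ?c else 0)
      + nval G x ?w (etgt e) i"
    unfolding nval_rec[OF v, of G x ?w i] by (rule sum.distrib)
  also have "(\<Sum>a\<in>incoming G (\<lambda>_. True) (etgt e). if gedges G ! a = e then ?c else 0) =
      w (k, i, j) * (edge_weight e * (gate_factor (gates G x w) e j * nval G x w (esrc e) j))"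
    by (subst sum.inter_filter[symmetric]) (simp_all add: edge_weight_def)
  finally show ?thesis .
qed

text \<open>\<open>AE_PiM_gauss_affine_nonzero\<close> applied to each entry of row \<open>i\<close>
  in turn: almost surely the sum vanishes only if all slopes do, that is, all inputs passed along
  \<open>e\<close>. The term \<open>H\<close> makes room for a skip connection added to a
  branch.\<close>

lemma AE_nval_affine:
  assumes e: "e \<in> set (gedges G)" "ekd e = Wt k" and i: "i < gdim G (etgt e)"
    and C: "C \<noteq> 0" and H: "H \<in> borel_measurable (wmeasure G)"
    and H_upd: "\<And>w j t. H (w((k, i, j) := t)) = H w"
  shows "AE w in wmeasure G. C * nval G x w (etgt e) i + H w = 0 \<longrightarrow>
    (\<forall>j\<in>{..<gdim G (esrc e)}. gate_factor (gates G x w) e j * nval G x w (esrc e) j = 0)"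
proof -
  have "AE w in wmeasure G. C * nval G x w (etgt e) i + H w = 0 \<longrightarrow>
    gate_factor (gates G x w) e j * nval G x w (esrc e) j = 0" if "j \<in> {..<gdim G (esrc e)}" for j
  proof -
    have j: "j < gdim G (esrc e)" using that by simp
    let ?p = "(k, i, j)"
    define a where "a w = C * (edge_weight e * (gate_factor (gates G x w) e j * nval G x w (esrc e) j))" for w
    \<comment> \<open>Setting the entry to 0 makes \<open>b\<close> independent of it. Measurability
      of \<open>b\<close> then comes from the splitting, as the whole minus the linear part.\<close>
    define b where "b w = C * nval G x (w(?p := 0)) (etgt e) i + H w" for w
    have src: "esrc e < etgt e" using edge_forward[OF e(1)] by simp
    have p: "?p \<in> wset G" by (rule wset_I[OF e i j])
    note [measurable] = nval_measurable[OF j] nval_measurable[OF i] weight_measurable[OF p] H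
    have ma[measurable]: "a \<in> borel_measurable (wmeasure G)"
      unfolding a_def[abs_def] gate_factor_def by measurable
    have split: "C * nval G x w (etgt e) i + H w = w ?p * a w + b w" for w
      unfolding a_def b_def nval_affine[OF e j, of x w i] by (simp add: algebra_simps)
    have "b = (\<lambda>w. C * nval G x w (etgt e) i + H w - w ?p * a w)"
      by (simp add: split)
    then have mb: "b \<in> borel_measurable (wmeasure G)" by simp
    have au: "a (w(?p := t)) = a w" for w t
      unfolding a_def by (simp only: gates_upd_below[OF e] nval_upd_below[OF e src])
    have bu: "b (w(?p := t)) = b w" for w t
      unfolding b_def by (simp add: H_upd)
    have "AE w in wmeasure G. a w \<noteq> 0 \<longrightarrow> w ?p * a w + b w \<noteq> 0"
      unfolding wmeasure_def
      by (rule AE_PiM_gauss_affine_nonzero[OF finite_wset p])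
        (use ma mb au bu in \<open>simp_all add: wmeasure_def\<close>)
    then show ?thesis
      by (rule AE_mp) (use C edge_weight_pos[OF e(1)] in \<open>auto simp: split a_def\<close>)
  qed
  then have "AE w in wmeasure G. \<forall>j\<in>{..<gdim G (esrc e)}. C * nval G x w (etgt e) i + H w = 0 \<longrightarrow>
    gate_factor (gates G x w) e j * nval G x w (esrc e) j = 0"
    by (intro AE_finite_allI) auto
  then show ?thesis by (rule AE_mp) auto
qed

lemma AE_nval_zero:
  assumes e: "e \<in> set (gedges G)" "ekd e = Wt k" and i: "i < gdim G (etgt e)"
  shows "AE w in wmeasure G. nval G x w (etgt e) i = 0 \<longrightarrow>
    (\<forall>j\<in>{..<gdim G (esrc e)}. gate_factor (gates G x w) e j * nval G x w (esrc e) j = 0)"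
  using AE_nval_affine[OF e i, of 1 "\<lambda>_. 0"] by simp

text \<open>If y = 0 at a gated unit, almost surely every gate factor on the edges into it is 0. The
  linear network sees the same gates, so z = 0 as well.\<close>

lemma AE_no_tie:
  assumes nonzero: "\<And>e. e \<in> set (gedges G) \<Longrightarrow> \<not> eact e \<Longrightarrow> etgt e \<in> active_nodes \<Longrightarrow>
    AE w in wmeasure G. \<exists>j<gdim G (esrc e). nval G x w (esrc e) j \<noteq> 0"
  shows "AE w in wmeasure G. no_tie q x w"
proof -
  have "AE w in wmeasure G. nval G x w v i = 0 \<longrightarrow> gated_lin G q (gates G x w) x w v i = 0"
    if vi: "(v, i) \<in> gated_units" for v i
  proof -
    have v: "v \<in> active_nodes" "i < gdim G v" "0 < v"
      using vi zero_not_active by (auto simp: gated_units_def intro: gr0I)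
    let ?Ev = "{e \<in> set (gedges G). etgt e = v}"
    have "AE w in wmeasure G. nval G x w v i = 0 \<longrightarrow> (\<forall>j\<in>{..<gdim G (esrc e)}. gate_factor (gates G x w) e j = 0)"
      if "e \<in> ?Ev" for e
    proof -
      from that have e: "e \<in> set (gedges G)" "etgt e = v" by auto
      have "ekd e \<noteq> Ident" using v(1) active_source_ident e by (auto simp: active_nodes_def)
      then obtain k where k: "ekd e = Wt k" by (cases "ekd e") auto
      have zero: "AE w in wmeasure G. nval G x w v i = 0 \<longrightarrow>
          (\<forall>j\<in>{..<gdim G (esrc e)}. gate_factor (gates G x w) e j * nval G x w (esrc e) j = 0)"
        using AE_nval_zero[OF e(1) k, of i x] v e(2) by simp
      show ?thesis
      proof (cases "eact e")
        case True
        \<comment> \<open>An open gate has a positive value behind it, so a vanishing product means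
          a closed gate.\<close>
        show ?thesis using zero by (rule AE_mp) (auto simp: gate_factor_def True)
      next
        case False
        \<comment> \<open>Without activation the factor is 1, and some source value is almost surely
          nonzero. The products then cannot all vanish, so y = 0 is itself a null event.\<close>
        have "AE w in wmeasure G. \<exists>j<gdim G (esrc e). nval G x w (esrc e) j \<noteq> 0"
          using nonzero[OF e(1) False] e(2) v by simp
        with zero show ?thesis by eventually_elim (auto simp: gate_factor_def False)
      qed
    qed
    then have "AE w in wmeasure G. \<forall>e\<in>?Ev. nval G x w v i = 0 \<longrightarrow> (\<forall>j\<in>{..<gdim G (esrc e)}. gate_factor (gates G x w) e j = 0)"
      by (intro AE_finite_allI) auto
    then show ?thesis
    proof (rule AE_mp, intro AE_I2 impI)
      fix w assume H: "\<forall>e\<in>?Ev. nval G x w v i = 0 \<longrightarrow> (\<forall>j\<in>{..<gdim G (esrc e)}. gate_factor (gates G x w) e j = 0)"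
        and y: "nval G x w v i = 0"
      show "gated_lin G q (gates G x w) x w v i = 0"
        unfolding gated_lin_rec[OF v(3)]
      proof (rule sum.neutral, rule ballI)
        fix a assume "a \<in> incoming G q v"
        then have a: "gedges G ! a \<in> ?Ev" by (auto simp: incoming_def)
        have "ekd (gedges G ! a) \<noteq> Ident" using v(1) active_source_ident a by (auto simp: active_nodes_def)
        then show "gated_contrib G w (gates G x w) (gated_lin G q (gates G x w) x w) (gedges G ! a) i = 0"
          using H[rule_format, OF a y] by (cases "ekd (gedges G ! a)") (auto simp: gated_contrib_def)
      qed
    qed
  qed
  then have "AE w in wmeasure G. \<forall>p\<in>gated_units. nval G x w (fst p) (snd p) = 0 \<longrightarrow>
      gated_lin G q (gates G x w) x w (fst p) (snd p) = 0"
    by (intro AE_finite_allI) (auto simp: gated_units_def active_nodes_def)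
  then show ?thesis by eventually_elim (auto simp: no_tie_def)
qed

section \<open>Averaging over the sign group\<close>

theorem Ew_net_out_subnet:
  assumes nonzero: "\<And>e. e \<in> set (gedges G) \<Longrightarrow> \<not> eact e \<Longrightarrow> etgt e \<in> active_nodes \<Longrightarrow>
    AE w in wmeasure G. \<exists>j<gdim G (esrc e). nval G x w (esrc e) j \<noteq> 0"
    and "even m"
  shows "Ew G (\<lambda>w. net_out (subnet G q) x w ^ m) =
    Ew G (\<lambda>w. gated_lin G q (gates G x w) x w (gout G) 0 ^ m)"
proof -
  let ?M = "wmeasure G"
  define r where "r w = net_out (subnet G q) x w ^ m" for w
  define z where "z w = gated_lin G q (gates G x w) x w (gout G) 0 ^ m" for w
  have o: "0 < gdim G (gout G)" using out_dim by simp
  have mr[measurable]: "r \<in> borel_measurable ?M" unfolding r_def[abs_def] net_out_def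
    using nval_subnet_measurable[OF o] by simp
  have mz[measurable]: "z \<in> borel_measurable ?M" unfolding z_def[abs_def]
    using gated_lin_measurable[OF o] by simp
  have aligned: "r (flip (align q x w) w) = z w" if "no_tie q x w" for w
  proof -
    have "align q x w (gout G, 0) ^ m = 1"
      using signs_range[OF align_signs, of q x w "(gout G, 0)"] \<open>even m\<close> by auto
    then show ?thesis
      using nval_subnet_flip_align[OF that o] by (simp add: r_def z_def net_out_def power_mult_distrib)
  qed
  \<comment> \<open>Following \<open>s\<close> by the aligning flip of \<open>flip s w\<close> is
    the bijection of \<open>align_bij\<close>; after reindexing by it, \<open>r\<close> and
    \<open>z\<close> agree term by term.\<close>
  have orbit: "(\<Sum>s\<in>signs. ennreal (r (flip s w))) = (\<Sum>s\<in>signs. ennreal (z (flip s w)))"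
    if "\<forall>s\<in>signs. no_tie q x (flip s w)" for w
  proof -
    have "(\<Sum>s\<in>signs. ennreal (r (flip s w))) =
        (\<Sum>s\<in>signs. ennreal (r (flip (\<lambda>p. align q x (flip s w) p * s p) w)))"
      by (rule sum.reindex_bij_betw[OF align_bij, symmetric])
    also have "\<dots> = (\<Sum>s\<in>signs. ennreal (z (flip s w)))"
      using that by (intro sum.cong refl) (simp add: aligned flip: flip_flip)
    finally show ?thesis .
  qed
  \<comment> \<open>Even powers are nonnegative, so the averaging is done with nonnegative
    integrals; the two expectations are recovered from them at the end.\<close>
  have invariant: "(\<integral>\<^sup>+w. ennreal (f (flip s w)) \<partial>?M) = (\<integral>\<^sup>+w. ennreal (f w) \<partial>?M)"
    if "s \<in> signs" and [measurable]: "f \<in> borel_measurable ?M" for f :: "weights \<Rightarrow> real" and s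
  proof -
    have "(\<integral>\<^sup>+w. ennreal (f w) \<partial>?M) = (\<integral>\<^sup>+w. ennreal (f w) \<partial>distr ?M ?M (flip s))"
      by (simp add: flip_measure_preserving[OF that(1)])
    also have "\<dots> = (\<integral>\<^sup>+w. ennreal (f (flip s w)) \<partial>?M)"
      by (rule nn_integral_distr) (use flip_measure_preserving[OF that(1)] in auto)
    finally show ?thesis ..
  qed
  have average: "of_nat (card signs) * (\<integral>\<^sup>+w. ennreal (f w) \<partial>?M) = (\<integral>\<^sup>+w. (\<Sum>s\<in>signs. ennreal (f (flip s w))) \<partial>?M)"
    if [measurable]: "f \<in> borel_measurable ?M" for f :: "weights \<Rightarrow> real"
  proof -
    have "(\<lambda>w. ennreal (f (flip s w))) \<in> borel_measurable ?M" if "s \<in> signs" for s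
      using measurable_compose[OF flip_measure_preserving(1)[OF that] \<open>f \<in> borel_measurable ?M\<close>] by simp
    then show ?thesis
      by (subst nn_integral_sum) (simp_all add: invariant)
  qed
  have "AE w in ?M. \<forall>s\<in>signs. no_tie q x (flip s w)"
  proof (rule AE_finite_allI[OF finite_signs])
    fix s assume s: "s \<in> signs"
    show "AE w in ?M. no_tie q x (flip s w)"
      by (rule AE_distrD[OF flip_measure_preserving(1)[OF s]])
        (unfold flip_measure_preserving(2)[OF s], rule AE_no_tie[OF nonzero])
  qed
  then have "(\<integral>\<^sup>+w. (\<Sum>s\<in>signs. ennreal (r (flip s w))) \<partial>?M) = (\<integral>\<^sup>+w. (\<Sum>s\<in>signs. ennreal (z (flip s w))) \<partial>?M)"
    by (intro nn_integral_cong_AE, eventually_elim) (rule orbit)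
  then have "of_nat (card signs) * (\<integral>\<^sup>+w. ennreal (r w) \<partial>?M) = of_nat (card signs) * (\<integral>\<^sup>+w. ennreal (z w) \<partial>?M)"
    by (simp add: average)
  moreover have "card signs \<noteq> 0" using finite_signs signs_one by auto
  ultimately have "(\<integral>\<^sup>+w. ennreal (r w) \<partial>?M) = (\<integral>\<^sup>+w. ennreal (z w) \<partial>?M)"
    by (simp add: ennreal_mult_cancel_left)
  moreover have "0 \<le> r w" "0 \<le> z w" for w
    using \<open>even m\<close> by (simp_all add: r_def z_def zero_le_even_power)
  ultimately have "integral\<^sup>L ?M r = integral\<^sup>L ?M z"
    by (simp add: integral_eq_nn_integral)
  then show ?thesis by (simp add: Ew_def r_def[abs_def] z_def[abs_def])
qed

text \<open>The interface to the two architectures: each has to exhibit a cut and to show that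
  ungated sources in front of gated units are almost surely not all 0.\<close>

theorem Ew_reduced_eq_Ew_f_path:
  fixes k q t all_via none_via
  assumes before: "\<And>e. e \<in> set (gedges G) \<Longrightarrow> etgt e < t \<Longrightarrow> q e"
    and none_via: "\<And>e. e \<in> set (gedges G) \<Longrightarrow> etgt e \<in> none_via \<Longrightarrow> esrc e \<in> none_via \<and> ekd e \<noteq> Wt k"
    and all_via: "\<And>e. e \<in> set (gedges G) \<Longrightarrow> etgt e \<in> all_via \<Longrightarrow> ekd e = Wt k \<or> esrc e \<in> all_via" "0 \<notin> all_via"
    and after: "\<And>e. e \<in> set (gedges G) \<Longrightarrow> t \<le> esrc e \<Longrightarrow> q e \<and> ekd e \<noteq> Wt k"
    and cross: "\<And>e. e \<in> set (gedges G) \<Longrightarrow> esrc e < t \<Longrightarrow> t \<le> etgt e \<Longrightarrow>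
      q e \<and> (ekd e = Wt k \<or> esrc e \<in> all_via) \<or> \<not> q e \<and> ekd e \<noteq> Wt k \<and> esrc e \<in> none_via"
    and t: "0 < t" "t \<le> gout G"
    and nonzero: "\<And>e. e \<in> set (gedges G) \<Longrightarrow> \<not> eact e \<Longrightarrow> etgt e \<in> active_nodes \<Longrightarrow>
      AE w in wmeasure G. \<exists>j<gdim G (esrc e). nval G x w (esrc e) j \<noteq> 0"
    and m: "even m"
  shows "Ew G (\<lambda>w. net_out (subnet G q) x w ^ m) = Ew G (\<lambda>w. f_path G k x w ^ m)"
proof -
  have "gated_lin G q (gates G x w) x w (gout G) 0 = f_path G k x w" for w
    unfolding f_path_eq by (rule gated_lin_cut[where all_via = all_via and none_via = none_via, OF assms(1-8)])
  then show ?thesis using Ew_net_out_subnet[OF nonzero m, where q = q] by simp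
qed

text \<open>For the residual sums of a ResNet. Grouping positions by edge collects multiplicities in
  \<open>edge_weight\<close>.\<close>

lemma nval_ident_node:
  assumes "0 < v" and ident: "\<And>e. e \<in> set (gedges G) \<Longrightarrow> etgt e = v \<Longrightarrow> ekd e = Ident"
  shows "nval G x w v i = (\<Sum>e | e \<in> set (gedges G) \<and> etgt e = v. edge_weight e * nval G x w (esrc e) i)"
proof -
  let ?A = "incoming G (\<lambda>_. True) v"
  have "nval G x w v i = (\<Sum>a\<in>?A. ecoef (gedges G ! a) * nval G x w (esrc (gedges G ! a)) i)"
    unfolding nval_rec[OF assms(1)]
  proof (rule sum.cong[OF refl])
    fix a assume "a \<in> ?A"
    then have a: "gedges G ! a \<in> set (gedges G)" "etgt (gedges G ! a) = v" by (auto simp: incoming_def)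
    note id = ident[OF a]
    show "gated_contrib G w (gates G x w) (nval G x w) (gedges G ! a) i =
        ecoef (gedges G ! a) * nval G x w (esrc (gedges G ! a)) i"
      using ident_edge[OF a(1) id] by (simp add: gated_contrib_def id gate_factor_def)
  qed
  also have "\<dots> = (\<Sum>e | e \<in> set (gedges G) \<and> etgt e = v.
      \<Sum>a\<in>{a\<in>?A. gedges G ! a = e}. ecoef (gedges G ! a) * nval G x w (esrc (gedges G ! a)) i)"
    by (rule sum.group[symmetric]) (auto simp: incoming_def)
  also have "\<dots> = (\<Sum>e | e \<in> set (gedges G) \<and> etgt e = v. edge_weight e * nval G x w (esrc e) i)"
    by (intro sum.cong refl) (auto simp: edge_weight_def)
  finally show ?thesis .
qed

text \<open>For the output of a ResNet branch, which only the last branch matrix enters.\<close>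

lemma nval_single_edge_zero:
  assumes e: "e \<in> set (gedges G)" "ekd e = Wt k"
    and single: "\<And>e'. e' \<in> set (gedges G) \<Longrightarrow> etgt e' = etgt e \<Longrightarrow> e' = e"
    and zero: "\<forall>j\<in>{..<gdim G (esrc e)}. gate_factor (gates G x w) e j * nval G x w (esrc e) j = 0"
  shows "nval G x w (etgt e) i = 0"
proof -
  have "0 < etgt e" using edge_forward[OF e(1)] by simp
  moreover have "gedges G ! a = e" if "a \<in> incoming G (\<lambda>_. True) (etgt e)" for a
    using that single by (auto simp: incoming_def)
  moreover have "gated_contrib G w (gates G x w) (nval G x w) e i = 0"
    using zero e(2) by (auto simp: gated_contrib_def intro!: sum.neutral)
  ultimately show ?thesis by (simp add: nval_rec cong: sum.cong)
qed

end

section \<open>DenseNets\<close>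

lemma unit_vector_nonzero:
  fixes x :: "nat \<Rightarrow> real"
  assumes "(\<Sum>i<n. (x i)\<^sup>2) = 1"
  shows "\<exists>j<n. x j \<noteq> 0"
proof (rule ccontr)
  assume "\<not> ?thesis"
  then have "(\<Sum>i<n. (x i)\<^sup>2) = 0" by (intro sum.neutral) auto
  then show False using assms by simp
qed

locale dense_net =
  fixes n0 :: nat and nd :: "nat \<Rightarrow> nat" and \<alpha> :: real and L :: nat and x :: "nat \<Rightarrow> real"
  assumes x: "(\<Sum>i<n0. (x i)\<^sup>2) = 1"
    and nd: "\<And>l. l \<le> L \<Longrightarrow> 0 < nd l" and \<alpha>: "0 < \<alpha>"
begin

abbreviation "G \<equiv> densenet n0 nd \<alpha> L"

lemmas input_nonzero = unit_vector_nonzero[OF x]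

lemma sel [simp]: "gout G = L + 2" "gdim G = dense_dim n0 nd L"
  by (simp_all add: densenet_def dense_graph_def)

lemma edges_cases:
  assumes "e \<in> set (gedges G)"
  obtains (First) "e = Edge 0 1 (Wt MIn) (1 / sqrt (real n0)) False"
    | (Hidden) l h where "e = Edge (h + 1) (l + 1) (Wt (MHid l h)) (sqrt (\<alpha> / (real (nd (l - 1)) * real l))) True"
        "h < l" "l \<le> L"
    | (Last) "e = Edge (L + 1) (L + 2) (Wt MOut) (1 / sqrt (real (nd L))) False"
  using assms by (auto simp: densenet_def dense_graph_def dense_edges_def)

lemma n0_pos: "0 < n0"
  using input_nonzero by auto

sublocale feedforward G
proof
  fix e assume e: "e \<in> set (gedges G)"
  show "esrc e < etgt e \<and> etgt e \<le> gout G" using e by (cases rule: edges_cases) auto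
  show "0 < ecoef e" using e
  proof (cases rule: edges_cases)
    case (Hidden l h)
    then show ?thesis using \<alpha> nd[of "l - 1"] by simp
  qed (use n0_pos nd in auto)
  show "gdim G (esrc e) = gdim G (etgt e) \<and> \<not> eact e" if "ekd e = Ident"
    using e that by (cases rule: edges_cases) auto
  show "0 < esrc e" if "eact e" using e that by (cases rule: edges_cases) auto
  fix e' assume e': "e' \<in> set (gedges G)"
  show "e = e'" if "ekd e = Wt k" "ekd e' = Wt k" for k
    using e e' that by (elim edges_cases) auto
  show "esrc e' \<noteq> esrc e \<and> etgt e' \<noteq> esrc e" if "ekd e' = Ident"
    using e' that by (cases rule: edges_cases) auto
qed (simp add: dense_dim_def)

text \<open>The edges without activation are the first and the last projection. The first reads the
  unit vector \<open>x\<close>; the last ends at the output, which is not gated.\<close>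

lemma nonzero:
  assumes "e \<in> set (gedges G)" "\<not> eact e" "etgt e \<in> active_nodes"
  shows "AE w in wmeasure G. \<exists>j<gdim G (esrc e). nval G x w (esrc e) j \<noteq> 0"
  using assms(1)
proof (cases rule: edges_cases)
  case First
  then show ?thesis using input_nonzero by (simp add: dense_dim_def)
next
  case (Hidden l h)
  then show ?thesis using assms by simp
next
  case Last
  then obtain e' where "e' \<in> set (gedges G)" "eact e'" "esrc e' = L + 2"
    using assms(3) by (auto simp: active_nodes_def)
  then show ?thesis by (cases rule: edges_cases) auto
qed

lemma dense_reduced_hidden:
  "dense_reduced n0 nd \<alpha> L (MHid lk hk) =
    subnet G (\<lambda>e. case ekd e of Wt (MHid l h) \<Rightarrow> if l = lk then h = hk else if lk < l then lk \<le> h else True | _ \<Rightarrow> True)"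
  by (auto simp: dense_reduced_def densenet_def dense_graph_def dense_edges_def filter_concat
      filter_map o_def)

lemma reduced_moment:
  assumes k: "k \<in> gkeys G" and m: "even m"
  shows "Ew G (\<lambda>w. net_out (dense_reduced n0 nd \<alpha> L k) x w ^ m) = Ew G (\<lambda>w. f_path G k x w ^ m)"
proof -
  obtain e where e: "e \<in> set (gedges G)" "ekd e = Wt k" using k by (auto simp: gkeys_def)
  from e(1) show ?thesis
  proof (cases rule: edges_cases)
    case First
    then have k: "k = MIn" using e by simp
    \<comment> \<open>Nothing is removed, so the cut may be put at the output: every node strictly
      between input and output is reached through the first projection only.\<close>
    have "Ew G (\<lambda>w. net_out (subnet G (\<lambda>_. True)) x w ^ m) = Ew G (\<lambda>w. f_path G k x w ^ m)"
      by (rule Ew_reduced_eq_Ew_f_path[where t = "L + 2" and all_via = "{1..<L + 2}" and none_via = "{}", OF _ _ _ _ _ _ _ _ nonzero m])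
        (auto elim!: edges_cases simp: k)
    then show ?thesis by (simp add: dense_reduced_def k)
  next
    case Last
    then have k: "k = MOut" using e by simp
    \<comment> \<open>Only the last projection crosses the cut at the output.\<close>
    have "Ew G (\<lambda>w. net_out (subnet G (\<lambda>_. True)) x w ^ m) = Ew G (\<lambda>w. f_path G k x w ^ m)"
      by (rule Ew_reduced_eq_Ew_f_path[where t = "L + 2" and all_via = "{}" and none_via = "{}", OF _ _ _ _ _ _ _ _ nonzero m])
        (auto elim!: edges_cases simp: k)
    then show ?thesis by (simp add: dense_reduced_def k)
  next
    case (Hidden lk hk)
    then have k: "k = MHid lk hk" using e by simp
    \<comment> \<open>The cut is at the target node \<open>lk + 1\<close> of the matrix. No earlier
      node lies behind the matrix, and every other edge across the cut bypasses it and is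
      removed.\<close>
    show ?thesis unfolding k dense_reduced_hidden
      by (rule Ew_reduced_eq_Ew_f_path[where t = "lk + 1" and all_via = "{}" and none_via = "{..lk}", OF _ _ _ _ _ _ _ _ nonzero m])
        (use Hidden in \<open>auto elim!: edges_cases\<close>)
  qed
qed

end

section \<open>ResNets\<close>

locale res_net =
  fixes n0 n :: nat and nb :: "nat \<Rightarrow> nat \<Rightarrow> nat" and \<alpha> :: "nat \<Rightarrow> real" and L mb :: nat
    and x :: "nat \<Rightarrow> real"
  assumes x: "(\<Sum>i<n0. (x i)\<^sup>2) = 1"
    and n: "0 < n" and mb: "1 \<le> mb"
    and nb_pos: "\<And>l h. l \<in> {1..L} \<Longrightarrow> h \<in> {1..mb} \<Longrightarrow> 0 < nb (l - 1) h"
    and nb_mb: "\<And>l. l \<in> {1..L} \<Longrightarrow> nb (l - 1) mb = n"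
    and \<alpha>: "\<And>l. l \<in> {1..L} \<Longrightarrow> 0 < \<alpha> l"
begin

abbreviation "G \<equiv> resnet n0 n nb \<alpha> L mb"

abbreviation "Y \<equiv> rY mb"

lemmas input_nonzero = unit_vector_nonzero[OF x]

lemma n0_pos: "0 < n0"
  using input_nonzero by auto

lemma sel [simp]: "gout G = Suc (Y L)" "gdim G = resnet_dim n0 n nb L mb"
  by (simp_all add: resnet_def resnet_graph_def)

section \<open>Node numbering and edges of a ResNet\<close>

lemma Y_0: "Y 0 = 1"
  by (simp add: rY_def)

lemma Y_Suc: "Y (Suc l) = Y l + mb + 1"
  by (simp add: rY_def)

lemma B_Suc: "rB mb (Suc l) h = Y l + h"
  by (simp add: rB_def rY_def)

lemma Y_less: "l < l' \<Longrightarrow> Y l + mb < Y l'"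
proof -
  assume "l < l'"
  then have "Suc l * (mb + 1) \<le> l' * (mb + 1)" by (intro mult_le_mono1) simp
  then show ?thesis by (simp add: rY_def)
qed

lemma Y_pos: "0 < Y l"
  by (simp add: rY_def)

lemma Y_le: "l \<le> l' \<Longrightarrow> Y l \<le> Y l'"
  using Y_less[of l l'] by (cases "l = l'") auto

text \<open>Each layer occupies a block of \<open>mb + 1\<close> consecutive numbers, so this is
  uniqueness of division with remainder.\<close>

lemma node_inject:
  assumes "h \<le> mb" "h' \<le> mb"
  shows "Y l + h = Y l' + h' \<longleftrightarrow> l = l' \<and> h = h'"
  using assms Y_less[of l l'] Y_less[of l' l] by (cases l l' rule: linorder_cases) auto

lemma dim_Y:
  assumes "l \<le> L"
  shows "gdim G (Y l) = n"
proof -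
  have "Y l \<noteq> Y L + 1" "Y l \<noteq> 0" using Y_le[OF assms] Y_pos[of l] by simp_all
  moreover have "(Y l - 1) mod (mb + 1) = 0" unfolding rY_def by (simp del: mult_Suc_right)
  ultimately show ?thesis by (simp add: resnet_dim_def)
qed

lemma dim_B:
  assumes "l < L" "1 \<le> h" "h \<le> mb"
  shows "gdim G (Y l + h) = nb l h"
proof -
  have "Y l + h < Y L" using Y_less[OF assms(1)] assms(3) by simp
  moreover have "Y l + h - 1 = h + l * (mb + 1)" by (simp add: rY_def)
  moreover have "(h + l * (mb + 1)) mod (mb + 1) = h" "(h + l * (mb + 1)) div (mb + 1) = l"
    using assms by (simp_all only: mod_mult_self1 div_mult_self1, simp_all)
  ultimately show ?thesis using assms by (simp add: resnet_dim_def)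
qed

text \<open>Layers are shifted from 1..L to 0..<L, which removes the truncated subtraction
  \<open>l - 1\<close> from the node numbers.\<close>

lemma resnet_edges_set:
  "set (resnet_edges n0 n nb \<alpha> L mb (\<lambda>_. False)) =
    {Edge 0 1 (Wt MIn) (1 / sqrt (real n0)) False, Edge (Y L) (Suc (Y L)) (Wt MOut) (1 / sqrt (real n)) False}
    \<union> (\<Union>l\<in>{..<L}.
       {Edge (Y l) (Y l + 1) (Wt (MHid (Suc l) 1)) (1 / sqrt (real n)) False,
        Edge (Y l + mb) (Y (Suc l)) Ident (sqrt (\<alpha> (Suc l))) False,
        Edge (Y l) (Y (Suc l)) Ident 1 False}
       \<union> (\<lambda>h. Edge (Y l + (h - 1)) (Y l + h) (Wt (MHid (Suc l) h)) (1 / sqrt (real (nb l (h - 1)))) True) ` {2..mb})"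
proof -
  have r: "set [1..<L + 1] = Suc ` {..<L}"
    unfolding image_Suc_lessThan by auto
  have r2: "set [2..<mb + 1] = {2..mb}" by auto
  show ?thesis
    unfolding resnet_edges_def set_append set_concat set_map r r2 image_image UN_simps
    by (auto simp: B_Suc)
qed

lemma edges_cases:
  assumes "e \<in> set (gedges G)"
  obtains (First) "e = Edge 0 1 (Wt MIn) (1 / sqrt (real n0)) False"
    | (Branch1) l where "e = Edge (Y l) (Y l + 1) (Wt (MHid (Suc l) 1)) (1 / sqrt (real n)) False" "l < L"
    | (Branch) l h where "e = Edge (Y l + (h - 1)) (Y l + h) (Wt (MHid (Suc l) h)) (1 / sqrt (real (nb l (h - 1)))) True"
        "l < L" "2 \<le> h" "h \<le> mb"
    | (Join) l where "e = Edge (Y l + mb) (Y (Suc l)) Ident (sqrt (\<alpha> (Suc l))) False" "l < L"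
    | (Skip) l where "e = Edge (Y l) (Y (Suc l)) Ident 1 False" "l < L"
    | (Last) "e = Edge (Y L) (Suc (Y L)) (Wt MOut) (1 / sqrt (real n)) False"
proof -
  have "e \<in> set (resnet_edges n0 n nb \<alpha> L mb (\<lambda>_. False))"
    using assms by (simp add: resnet_def resnet_graph_def)
  then show ?thesis unfolding resnet_edges_set
    by (elim UnE UN_E insertE emptyE imageE)
      (rule that(1,6), assumption | rule that(2,4,5), assumption, simp | rule that(3), assumption, simp, simp, simp)+
qed

lemma edges_I:
  "Edge 0 1 (Wt MIn) (1 / sqrt (real n0)) False \<in> set (gedges G)"
  "l < L \<Longrightarrow> Edge (Y l) (Y l + 1) (Wt (MHid (Suc l) 1)) (1 / sqrt (real n)) False \<in> set (gedges G)"
  "l < L \<Longrightarrow> 2 \<le> h \<Longrightarrow> h \<le> mb \<Longrightarrow>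
     Edge (Y l + (h - 1)) (Y l + h) (Wt (MHid (Suc l) h)) (1 / sqrt (real (nb l (h - 1)))) True \<in> set (gedges G)"
  "l < L \<Longrightarrow> Edge (Y l + mb) (Y (Suc l)) Ident (sqrt (\<alpha> (Suc l))) False \<in> set (gedges G)"
  "l < L \<Longrightarrow> Edge (Y l) (Y (Suc l)) Ident 1 False \<in> set (gedges G)"
proof -
  have G: "gedges G = resnet_edges n0 n nb \<alpha> L mb (\<lambda>_. False)"
    by (simp add: resnet_def resnet_graph_def)
  show "Edge 0 1 (Wt MIn) (1 / sqrt (real n0)) False \<in> set (gedges G)"
    unfolding G resnet_edges_set by blast
  assume l: "l < L"
  show "Edge (Y l) (Y l + 1) (Wt (MHid (Suc l) 1)) (1 / sqrt (real n)) False \<in> set (gedges G)"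
    "Edge (Y l + mb) (Y (Suc l)) Ident (sqrt (\<alpha> (Suc l))) False \<in> set (gedges G)"
    "Edge (Y l) (Y (Suc l)) Ident 1 False \<in> set (gedges G)"
    unfolding G resnet_edges_set using l by blast+
  assume "2 \<le> h" "h \<le> mb"
  then have "h \<in> {2..mb}" by simp
  then show "Edge (Y l + (h - 1)) (Y l + h) (Wt (MHid (Suc l) h)) (1 / sqrt (real (nb l (h - 1)))) True \<in> set (gedges G)"
    unfolding G resnet_edges_set using l by blast
qed

text \<open>Gated nodes lie strictly inside a branch, hence never at an end of an identity
  edge.\<close>

lemma active_edge:
  assumes "e \<in> set (gedges G)" "eact e"
  obtains l h where "l < L" "1 \<le> h" "h < mb" "esrc e = Y l + h"
  using assms(1)
proof (cases rule: edges_cases)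
  case (Branch l h)
  then show ?thesis by (intro that[of l "h - 1"]) auto
qed (use assms in auto)

sublocale feedforward G
proof
  fix e assume e: "e \<in> set (gedges G)"
  show "esrc e < etgt e \<and> etgt e \<le> gout G" using e
  proof (cases rule: edges_cases)
    case (Branch1 l)
    then show ?thesis using Y_less[of l L] by simp
  next
    case (Branch l h)
    then show ?thesis using Y_less[of l L] by simp
  next
    case (Join l)
    then show ?thesis using Y_le[of "Suc l" L] by (simp add: Y_Suc)
  next
    case (Skip l)
    then show ?thesis using Y_le[of "Suc l" L] by (simp add: Y_Suc)
  qed (use Y_le[of 0 L] in \<open>simp_all add: Y_0\<close>)
  show "0 < ecoef e" using e
  proof (cases rule: edges_cases)
    case (Branch l h)
    then have "0 < nb (Suc l - 1) (h - 1)" by (intro nb_pos) auto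
    then show ?thesis using Branch by simp
  next
    case (Join l)
    then show ?thesis using \<alpha>[of "Suc l"] by simp
  qed (use n0_pos n in auto)
  show "gdim G (esrc e) = gdim G (etgt e) \<and> \<not> eact e" if "ekd e = Ident"
    using e
  proof (cases rule: edges_cases)
    case (Join l)
    then show ?thesis using dim_B[of l mb] dim_Y[of "Suc l"] mb nb_mb[of "Suc l"] by simp
  next
    case (Skip l)
    then show ?thesis using dim_Y[of l] dim_Y[of "Suc l"] by simp
  qed (use that in auto)
  show "0 < esrc e" if "eact e" using active_edge[OF e that] Y_pos by (metis add_pos_nonneg zero_le)
  fix e' assume e': "e' \<in> set (gedges G)"
  show "e = e'" if "ekd e = Wt k" "ekd e' = Wt k" for k
    using e e' that by (elim edges_cases) auto
  show "esrc e' \<noteq> esrc e \<and> etgt e' \<noteq> esrc e" if "eact e" "ekd e' = Ident"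
  proof -
    obtain l h where lh: "1 \<le> h" "h < mb" "esrc e = Y l + h" using active_edge[OF e \<open>eact e\<close>] by metis
    have ne: "Y l' + mb \<noteq> Y l + h" "Y l' \<noteq> Y l + h" for l'
      using lh node_inject[of mb h l' l] node_inject[of 0 h l' l] by auto
    show ?thesis using e' by (cases rule: edges_cases) (use that ne lh(3) in auto)
  qed
next
  show "gdim G (gout G) = 1" by (simp add: resnet_dim_def)
qed

lemma into_Y:
  assumes "l < L"
  shows "{e. e \<in> set (gedges G) \<and> etgt e = Y (Suc l)} =
    {Edge (Y l + mb) (Y (Suc l)) Ident (sqrt (\<alpha> (Suc l))) False, Edge (Y l) (Y (Suc l)) Ident 1 False}"
proof -
  have "e = Edge (Y l + mb) (Y (Suc l)) Ident (sqrt (\<alpha> (Suc l))) False \<or> e = Edge (Y l) (Y (Suc l)) Ident 1 False"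
    if e: "e \<in> set (gedges G)" and t: "etgt e = Y (Suc l)" for e
    using e
  proof (cases rule: edges_cases)
    case First
    then show ?thesis using t node_inject[of 0 0 0 "Suc l"] by (simp add: Y_0)
  next
    case (Branch1 l')
    then show ?thesis using t node_inject[of 1 0 l' "Suc l"] mb by simp
  next
    case (Branch l' h)
    then show ?thesis using t node_inject[of h 0 l' "Suc l"] by simp
  next
    case (Join l')
    then show ?thesis using t node_inject[of 0 0 "Suc l'" "Suc l"] by simp
  next
    case (Skip l')
    then show ?thesis using t node_inject[of 0 0 "Suc l'" "Suc l"] by simp
  next
    case Last
    then show ?thesis using t Y_le[of "Suc l" L] assms by simp
  qed
  then show ?thesis using edges_I(4,5)[OF assms] by auto
qed

text \<open>The target determines the matrix on the edge, and \<open>key_unique\<close> does the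
  rest.\<close>

lemma into_B:
  assumes "l < L" "e \<in> set (gedges G)" "e' \<in> set (gedges G)" "etgt e = Y l + h" "etgt e' = Y l + h" "1 \<le> h" "h \<le> mb"
  shows "e = e'"
proof -
  have *: "ekd e = Wt (MHid (Suc l) h)" if e: "e \<in> set (gedges G)" and t: "etgt e = Y l + h" for e
    using e
  proof (cases rule: edges_cases)
    case First
    then show ?thesis using t node_inject[of 0 h 0 l] assms by (simp add: Y_0)
  next
    case (Branch1 l')
    then show ?thesis using t node_inject[of 1 h l' l] assms by simp
  next
    case (Branch l' h')
    then show ?thesis using t node_inject[of h' h l' l] assms by simp
  next
    case (Join l')
    then show ?thesis using t node_inject[of 0 h "Suc l'" l] assms by simp
  next
    case (Skip l')
    then show ?thesis using t node_inject[of 0 h "Suc l'" l] assms by simp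
  next
    case Last
    then show ?thesis using t Y_less[of l L] assms by simp
  qed
  show ?thesis using key_unique[OF assms(2,3) *[OF assms(2,4)] *[OF assms(3,5)]] .
qed

text \<open>The residual sum is affine in the last branch matrix, with the skip connection as
  constant term \<open>H\<close>. Almost surely it vanishes only if all inputs to that matrix do;
  then the branch output is 0, and the skip term alone, nonzero by induction, would have to
  vanish.\<close>

lemma AE_residual_nonzero:
  "l \<le> L \<Longrightarrow> AE w in wmeasure G. nval G x w (Y l) 0 \<noteq> 0"
proof (induction l)
  case 0
  have "AE w in wmeasure G. nval G x w 1 0 = 0 \<longrightarrow> (\<forall>j\<in>{..<n0}. x j = 0)"
    using AE_nval_zero[OF edges_I(1), of MIn 0 x] dim_Y[of 0] n
    by (simp add: Y_0 gate_factor_def resnet_dim_def)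
  then show ?case by eventually_elim (use input_nonzero in \<open>auto simp: Y_0\<close>)
next
  case (Suc l)
  then have l: "l < L" by simp
  let ?J = "Edge (Y l + mb) (Y (Suc l)) Ident (sqrt (\<alpha> (Suc l))) False"
  let ?S = "Edge (Y l) (Y (Suc l)) Ident 1 False"
  \<comment> \<open>The edge of the last branch matrix; for \<open>mb = 1\<close> this is also the
    first one and has no activation.\<close>
  obtain e k where e: "e \<in> set (gedges G)" "ekd e = Wt k" "etgt e = Y l + mb"
  proof (cases "mb = 1")
    case True
    then show ?thesis using edges_I(2)[OF l] that by fastforce
  next
    case False
    then show ?thesis using edges_I(3)[OF l, of mb] mb that by fastforce
  qed
  have y: "nval G x w (Y (Suc l)) 0 = edge_weight ?J * nval G x w (Y l + mb) 0 + edge_weight ?S * nval G x w (Y l) 0" for w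
  proof -
    have "nval G x w (Y (Suc l)) 0 = (\<Sum>e\<in>{?J, ?S}. edge_weight e * nval G x w (esrc e) 0)"
      unfolding into_Y[OF l, symmetric]
    proof (rule nval_ident_node[OF Y_pos])
      fix e assume "e \<in> set (gedges G)" "etgt e = Y (Suc l)"
      then have "e \<in> {?J, ?S}" using into_Y[OF l] by blast
      then show "ekd e = Ident" by (elim insertE emptyE) simp_all
    qed
    moreover have "?J \<noteq> ?S" using mb by simp
    ultimately show ?thesis by simp
  qed
  have pos: "0 < edge_weight ?J" "0 < edge_weight ?S"
    using edges_I(4,5)[OF l] by (auto intro: edge_weight_pos)
  have "AE w in wmeasure G. edge_weight ?J * nval G x w (etgt e) 0 + edge_weight ?S * nval G x w (Y l) 0 = 0 \<longrightarrow>
    (\<forall>j\<in>{..<gdim G (esrc e)}. gate_factor (gates G x w) e j * nval G x w (esrc e) j = 0)"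
  proof (rule AE_nval_affine[OF e(1,2)])
    show "0 < gdim G (etgt e)" unfolding e(3) using dim_B[OF l mb] nb_mb[of "Suc l"] l n by simp
    show "edge_weight ?J \<noteq> 0" using pos by simp
    show "(\<lambda>w. edge_weight ?S * nval G x w (Y l) 0) \<in> borel_measurable (wmeasure G)"
      using nval_measurable[of 0 "Y l" x] dim_Y[of l] n l by simp
    show "edge_weight ?S * nval G x (w((k, 0, j) := t)) (Y l) 0 = edge_weight ?S * nval G x w (Y l) 0" for w j t
      using nval_upd_below[OF e(1,2), of "Y l"] e(3) mb by simp
  qed
  then show ?case using Suc.IH[OF less_imp_le[OF l]]
  proof eventually_elim
    fix w assume z: "edge_weight ?J * nval G x w (etgt e) 0 + edge_weight ?S * nval G x w (Y l) 0 = 0 \<longrightarrow>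
        (\<forall>j\<in>{..<gdim G (esrc e)}. gate_factor (gates G x w) e j * nval G x w (esrc e) j = 0)"
      and nz: "nval G x w (Y l) 0 \<noteq> 0"
    show "nval G x w (Y (Suc l)) 0 \<noteq> 0"
    proof
      assume 0: "nval G x w (Y (Suc l)) 0 = 0"
      have "nval G x w (etgt e) 0 = 0"
        by (rule nval_single_edge_zero[OF e(1,2)])
          (use into_B[OF l _ e(1) _ e(3) mb] e(3) z 0 y[of w] in auto)
      then show False using 0 y[of w] e(3) pos nz by simp
    qed
  qed
qed

text \<open>The only edge without activation into a gated unit is the first of its branch, and it
  starts at a residual sum.\<close>

lemma nonzero:
  assumes e: "e \<in> set (gedges G)" "\<not> eact e" "etgt e \<in> active_nodes"
  shows "AE w in wmeasure G. \<exists>j<gdim G (esrc e). nval G x w (esrc e) j \<noteq> 0"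
proof -
  obtain l h where lh: "l < L" "1 \<le> h" "h < mb" "etgt e = Y l + h"
    using e(3) active_edge by (auto simp: active_nodes_def) metis
  have "esrc e = Y l"
  proof (cases "h = 1")
    case True
    then show ?thesis using into_B[OF lh(1) e(1) edges_I(2)[OF lh(1)], of h] lh by simp
  next
    case False
    then show ?thesis using into_B[OF lh(1) e(1) edges_I(3)[OF lh(1), of h], of h] lh e(2) by auto
  qed
  moreover have "AE w in wmeasure G. nval G x w (Y l) 0 \<noteq> 0"
    using AE_residual_nonzero[of l] lh(1) by simp
  then have "AE w in wmeasure G. \<exists>j<gdim G (Y l). nval G x w (Y l) j \<noteq> 0"
    by eventually_elim (use dim_Y[of l] lh(1) n in auto)
  ultimately show ?thesis by simp
qed

lemma resnet_reduced_hidden: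
  "resnet_reduced n0 n nb \<alpha> L mb (MHid (Suc lk) h) =
    subnet G (\<lambda>e. e \<noteq> Edge (Y lk) (Y (Suc lk)) Ident 1 False)"
proof -
  have inj: "Y l = Y l' \<longleftrightarrow> l = l'" for l l' using node_inject[of 0 0 l l'] by simp
  have map_eq: "map f [1..<L + 1] = map g [1..<L + 1]" if "\<And>l. f (Suc l) = g (Suc l)" for f g :: "nat \<Rightarrow> edge list"
    using that by (intro map_cong refl) (metis Suc_le_D atLeastLessThan_iff One_nat_def set_upt)
  \<comment> \<open>\<open>mb\<close> separates the skip edge from the join edge of its layer: their
    sources differ even when their coefficients coincide.\<close>
  show ?thesis using mb
    by (auto simp: resnet_reduced_def resnet_def resnet_graph_def resnet_edges_def filter_concat
        filter_map o_def inj B_Suc intro!: arg_cong[where f = concat] map_eq)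
qed

lemma reduced_moment:
  assumes k: "k \<in> gkeys G" and m: "even m"
  shows "Ew G (\<lambda>w. net_out (resnet_reduced n0 n nb \<alpha> L mb k) x w ^ m) = Ew G (\<lambda>w. f_path G k x w ^ m)"
proof -
  obtain e where e: "e \<in> set (gedges G)" "ekd e = Wt k" using k by (auto simp: gkeys_def)
  have fwd: "esrc e < etgt e" "etgt e \<le> Suc (Y L)" if "e \<in> set (gedges G)" for e
    using edge_forward[OF that] by simp_all
  have inner: "etgt e < Suc (Y L)" if "e \<in> set (gedges G)" "ekd e \<noteq> Wt MOut" for e
    using that(1)
  proof (cases rule: edges_cases)
    case (Branch1 l)
    then show ?thesis using Y_less[of l L] mb by simp
  next
    case (Branch l h)
    then show ?thesis using Y_less[of l L] by simp
  next
    case (Join l)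
    then show ?thesis using Y_le[of "Suc l" L] by simp
  next
    case (Skip l)
    then show ?thesis using Y_le[of "Suc l" L] by simp
  qed (use that Y_pos in auto)
  have first: "ekd e = Wt MIn \<or> 0 < esrc e" if "e \<in> set (gedges G)" for e
    using that Y_pos by (cases rule: edges_cases) auto
  have hidden: "Ew G (\<lambda>w. net_out (resnet_reduced n0 n nb \<alpha> L mb k) x w ^ m) = Ew G (\<lambda>w. f_path G k x w ^ m)"
    if k: "k = MHid (Suc lk) hk" and lk: "lk < L" and hk: "1 \<le> hk" "hk \<le> mb" for lk hk
  proof -
    let ?q = "\<lambda>e. e \<noteq> Edge (Y lk) (Y (Suc lk)) Ident 1 False"
    have keyk: "etgt e = Y lk + hk" if "e \<in> set (gedges G)" "ekd e = Wt k" for e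
      using that k by (elim edges_cases) auto
    \<comment> \<open>The cut is at the residual sum closing the layer. The branch nodes from the
      target of the matrix on are reached only through it, and all nodes before that target, the
      start of the skip edge among them, never.\<close>
    show ?thesis unfolding k resnet_reduced_hidden unfolding k[symmetric]
    proof (rule Ew_reduced_eq_Ew_f_path[where t = "Y (Suc lk)" and all_via = "{Y lk + hk..<Y (Suc lk)}"
          and none_via = "{..<Y lk + hk}", OF _ _ _ _ _ _ _ _ nonzero m])
      fix e assume e: "e \<in> set (gedges G)"
      show "?q e" if "etgt e < Y (Suc lk)" using that by auto
      show "esrc e \<in> {..<Y lk + hk} \<and> ekd e \<noteq> Wt k" if "etgt e \<in> {..<Y lk + hk}"
        using that keyk[OF e] fwd[OF e] by auto
      show "?q e \<and> ekd e \<noteq> Wt k" if "Y (Suc lk) \<le> esrc e"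
        using that keyk[OF e] fwd[OF e] hk by (auto simp: Y_Suc)
      show "ekd e = Wt k \<or> esrc e \<in> {Y lk + hk..<Y (Suc lk)}" if t: "etgt e \<in> {Y lk + hk..<Y (Suc lk)}"
      proof -
        obtain h where h: "etgt e = Y lk + h" "hk \<le> h" "h \<le> mb"
          using t by (intro that[of "etgt e - Y lk"]) (auto simp: Y_Suc)
        show ?thesis
        proof (cases "h = 1")
          case True
          then show ?thesis using into_B[OF lk e edges_I(2)[OF lk], of h] h hk k by auto
        next
          case False
          then show ?thesis using into_B[OF lk e edges_I(3)[OF lk, of h], of h] h hk k by (auto simp: Y_Suc)
        qed
      qed
      show "?q e \<and> (ekd e = Wt k \<or> esrc e \<in> {Y lk + hk..<Y (Suc lk)}) \<or>
          \<not> ?q e \<and> ekd e \<noteq> Wt k \<and> esrc e \<in> {..<Y lk + hk}"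
        if s: "esrc e < Y (Suc lk)" and t: "Y (Suc lk) \<le> etgt e"
      proof -
        \<comment> \<open>No edge jumps over a residual sum, so only its own join and skip edges
          cross the cut.\<close>
        have "etgt e = Y (Suc lk)" using e
        proof (cases rule: edges_cases)
          case First
          then show ?thesis using t mb by (simp add: Y_Suc)
        next
          case (Branch1 l)
          then show ?thesis using s t Y_less[of l "Suc lk"] mb by (cases "l < Suc lk") (use Y_le[of "Suc lk" l] in auto)
        next
          case (Branch l h)
          then show ?thesis using s t Y_less[of l "Suc lk"] by (cases "l < Suc lk") (use Y_le[of "Suc lk" l] in auto)
        next
          case (Join l)
          then show ?thesis using s t Y_less[of l lk] Y_le[of "Suc lk" l]
            by (cases l lk rule: linorder_cases) (auto simp: Y_Suc)
        next
          case (Skip l)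
          then show ?thesis using s t Y_less[of l lk] Y_le[of "Suc lk" l]
            by (cases l lk rule: linorder_cases) (auto simp: Y_Suc)
        next
          case Last
          then show ?thesis using s Y_le[of "Suc lk" L] lk by simp
        qed
        then have "e \<in> {Edge (Y lk + mb) (Y (Suc lk)) Ident (sqrt (\<alpha> (Suc lk))) False, Edge (Y lk) (Y (Suc lk)) Ident 1 False}"
          using into_Y[OF lk] e by blast
        then show ?thesis using hk by (auto simp: Y_Suc)
      qed
    qed (use Y_le[of "Suc lk" L] lk Y_pos hk in auto)
  qed
  from e(1) show ?thesis
  proof (cases rule: edges_cases)
    case First
    then have k: "k = MIn" using e by simp
    \<comment> \<open>As for a DenseNet, the cut is at the output, and all inner nodes lie behind
      the first projection.\<close>
    have "Ew G (\<lambda>w. net_out (subnet G (\<lambda>_. True)) x w ^ m) = Ew G (\<lambda>w. f_path G k x w ^ m)"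
      by (rule Ew_reduced_eq_Ew_f_path[where t = "Suc (Y L)" and all_via = "{1..<Suc (Y L)}" and none_via = "{}", OF _ _ _ _ _ _ _ _ nonzero m])
        (use fwd first inner k in \<open>force+\<close>)
    then show ?thesis by (simp add: resnet_reduced_def k)
  next
    case Last
    then have k: "k = MOut" using e by simp
    have "Ew G (\<lambda>w. net_out (subnet G (\<lambda>_. True)) x w ^ m) = Ew G (\<lambda>w. f_path G k x w ^ m)"
      by (rule Ew_reduced_eq_Ew_f_path[where t = "Suc (Y L)" and all_via = "{}" and none_via = "{}", OF _ _ _ _ _ _ _ _ nonzero m])
        (use fwd inner k in \<open>force+\<close>)
    then show ?thesis by (simp add: resnet_reduced_def k)
  next
    case (Branch1 l)
    then show ?thesis using e(2) mb by (intro hidden) auto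
  next
    case (Branch l h)
    then show ?thesis using e(2) by (intro hidden) auto
  qed (use e in auto)
qed

end

section \<open>Both architectures together\<close>

theorem theorem1:
  fixes x :: "nat \<Rightarrow> real" and n0 :: nat and m :: nat
  assumes unit_x: "(\<Sum>i<n0. (x i)\<^sup>2) = 1"
    and even_m: "even m"
  shows
    "(\<forall>(n::nat) (nb::nat \<Rightarrow> nat \<Rightarrow> nat) (\<alpha>::nat \<Rightarrow> real) (L::nat) (mb::nat).
        0 < n \<and> 1 \<le> L \<and> 1 \<le> mb
        \<and> (\<forall>l\<in>{1..L}. \<forall>h\<in>{1..mb}. 0 < nb (l - 1) h)
        \<and> (\<forall>l\<in>{1..L}. nb (l - 1) mb = n)
        \<and> (\<forall>l\<in>{1..L}. 0 < \<alpha> l)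
        \<longrightarrow> (\<forall>k \<in> gkeys (resnet n0 n nb \<alpha> L mb).
              Ew (resnet n0 n nb \<alpha> L mb)
                 (\<lambda>w. (net_out (resnet_reduced n0 n nb \<alpha> L mb k) x w) ^ m)
            = Ew (resnet n0 n nb \<alpha> L mb)
                 (\<lambda>w. (f_path (resnet n0 n nb \<alpha> L mb) k x w) ^ m)))
     \<and> (\<forall>(nd::nat \<Rightarrow> nat) (\<alpha>::real) (L::nat).
        1 \<le> L \<and> (\<forall>l\<le>L. 0 < nd l) \<and> 0 < \<alpha>
        \<longrightarrow> (\<forall>k \<in> gkeys (densenet n0 nd \<alpha> L).
              Ew (densenet n0 nd \<alpha> L)
                 (\<lambda>w. (net_out (dense_reduced n0 nd \<alpha> L k) x w) ^ m)
            = Ew (densenet n0 nd \<alpha> L)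
                 (\<lambda>w. (f_path (densenet n0 nd \<alpha> L) k x w) ^ m)))"
proof (intro conjI allI impI ballI)
  fix n L mb :: nat and nb :: "nat \<Rightarrow> nat \<Rightarrow> nat" and \<alpha> :: "nat \<Rightarrow> real" and k
  assume H: "0 < n \<and> 1 \<le> L \<and> 1 \<le> mb
      \<and> (\<forall>l\<in>{1..L}. \<forall>h\<in>{1..mb}. 0 < nb (l - 1) h)
      \<and> (\<forall>l\<in>{1..L}. nb (l - 1) mb = n)
      \<and> (\<forall>l\<in>{1..L}. 0 < \<alpha> l)"
    and k: "k \<in> gkeys (resnet n0 n nb \<alpha> L mb)"
  interpret res_net n0 n nb \<alpha> L mb x
    by standard (use H unit_x in blast)+
  show "Ew (resnet n0 n nb \<alpha> L mb) (\<lambda>w. (net_out (resnet_reduced n0 n nb \<alpha> L mb k) x w) ^ m)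
    = Ew (resnet n0 n nb \<alpha> L mb) (\<lambda>w. (f_path (resnet n0 n nb \<alpha> L mb) k x w) ^ m)"
    by (rule reduced_moment[OF k even_m])
next
  fix nd :: "nat \<Rightarrow> nat" and \<alpha> :: real and L :: nat and k
  assume H: "1 \<le> L \<and> (\<forall>l\<le>L. 0 < nd l) \<and> 0 < \<alpha>" and k: "k \<in> gkeys (densenet n0 nd \<alpha> L)"
  interpret dense_net n0 nd \<alpha> L x
    by standard (use H unit_x in blast)+
  show "Ew (densenet n0 nd \<alpha> L) (\<lambda>w. (net_out (dense_reduced n0 nd \<alpha> L k) x w) ^ m)
    = Ew (densenet n0 nd \<alpha> L) (\<lambda>w. (f_path (densenet n0 nd \<alpha> L) k x w) ^ m)"
    by (rule reduced_moment[OF k even_m])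
qed

end
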